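(* Let $A$ be a separable C*-algebra. The strict topology and the strongly uniform topology $\mathrm{su}$ agree on the norm-bounded subsets of $A$.
   Context: The strict topology on $A$ is the locally convex topology generated by the seminorms $a\mapsto\|ba\|$ and $a\mapsto\|ab\|$ for $b\in A$. For each weak* compact subset $K$ of the state space $S(A)$ of $A$, let $q_K(a)=\sup_{\varphi\in K}\max\{\sqrt{\varphi(a^*a)},\sqrt{\varphi(aa^* )}\}$ for $a\in A$. The strongly uniform topology $\mathrm{su}$ is the locally convex topology on $A$ generated by all the seminorms $q_K$, $K$ ranging over the weak* compact subsets of $S(A)$. *)

theory Defs
  imports "HOL-Analysis.Analysis"
begin

text \<open>
  C*-algebras, not assumed to be unital, and with the zero algebra allowed. The library has real but
  not complex normed algebras, so the complex scalar multiplication is added to a real Banach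
  algebra, whose real structure it has to extend.
\<close>

class cstar_algebra = real_normed_algebra + banach +
  fixes scaleC :: "complex \<Rightarrow> 'a \<Rightarrow> 'a"
    and star :: "'a \<Rightarrow> 'a"
  assumes scaleC_of_real: "scaleC (complex_of_real r) x = scaleR r x"
    and scaleC_add_right: "scaleC c (x + y) = scaleC c x + scaleC c y"
    and scaleC_add_left: "scaleC (c + d) x = scaleC c x + scaleC d x"
    and scaleC_scaleC: "scaleC c (scaleC d x) = scaleC (c * d) x"
    and mult_scaleC_left: "scaleC c x * y = scaleC c (x * y)"
    and mult_scaleC_right: "x * scaleC c y = scaleC c (x * y)"
    and norm_scaleC: "norm (scaleC c x) = cmod c * norm x"
    and star_star: "star (star x) = x"
    and star_add: "star (x + y) = star x + star y"
    and star_scaleC: "star (scaleC c x) = scaleC (cnj c) (star x)"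
    and star_mult: "star (x * y) = star y * star x"
    and cstar_identity: "norm (star x * x) = (norm x)\<^sup>2"

definition dual_space :: "('a::cstar_algebra \<Rightarrow> complex) set" where
  "dual_space = {\<phi>. bounded_linear \<phi> \<and> (\<forall>c a. \<phi> (scaleC c a) = c * \<phi> a)}"

definition state_space :: "('a::cstar_algebra \<Rightarrow> complex) set" where
  "state_space = {\<phi> \<in> dual_space. (\<forall>a. \<phi> (star a * a) \<in> \<real>\<^sub>\<ge>\<^sub>0) \<and> onorm \<phi> = 1}"

text \<open>The weak* topology is the topology of pointwise convergence on the dual.\<close>

definition weak_star_topology :: "('a::cstar_algebra \<Rightarrow> complex) topology" where
  "weak_star_topology = subtopology (product_topology (\<lambda>_. euclidean) UNIV) dual_space"

text \<open>
  The open balls of the seminorms form a subbase. The whole space is inserted so that the empty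
  family generates the indiscrete topology on it.
\<close>

definition seminorm_topology :: "('a::real_vector \<Rightarrow> real) set \<Rightarrow> 'a topology" where
  "seminorm_topology P =
     topology_generated_by (insert UNIV {{y. p (y - x) < e} | p x e. p \<in> P \<and> e > 0})"

lemma topspace_seminorm_topology [simp]: "topspace (seminorm_topology P) = UNIV"
  unfolding seminorm_topology_def topology_generated_by_topspace by simp

definition strict_topology :: "'a::cstar_algebra topology" where
  "strict_topology =
     seminorm_topology (range (\<lambda>b a. norm (b * a)) \<union> range (\<lambda>b a. norm (a * b)))"

text \<open>
  \<open>Re\<close> only converts the type, as states are nonnegative on \<open>star a * a\<close> and \<open>a * star a\<close>. The
  supremum over the empty set of states is taken to be \<open>0\<close>; the library leaves it unspecified.
\<close>

definition su_seminorm :: "('a::cstar_algebra \<Rightarrow> complex) set \<Rightarrow> 'a \<Rightarrow> real" where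
  "su_seminorm K a =
     (if K = {} then 0
      else SUP \<phi>\<in>K. max (sqrt (Re (\<phi> (star a * a)))) (sqrt (Re (\<phi> (a * star a)))))"

definition su_topology :: "'a::cstar_algebra topology" where
  "su_topology =
     seminorm_topology {su_seminorm K | K. K \<subseteq> state_space \<and> compactin weak_star_topology K}"

end

theory Submission
  imports Defs
begin

text \<open>
  Both inclusions come from quantitative comparisons of seminorms on a ball of radius \<open>R\<close>.

  A strict neighbourhood lies in a given \<open>su\<close>-neighbourhood because the states in
  a weak* compact set \<open>K\<close> attain their norm uniformly: as every state has norm 1, finitely many \<open>x\<close> in the unit
  ball suffice to make \<open>Re (\<phi> x)\<close> close to 1, for each \<open>\<phi>\<close> in \<open>K\<close> at one of them. If in addition
  \<open>a * x\<close> is small, then \<open>x + t *\<^sub>R (star a * a)\<close> has norm at most about \<open>1\<close>, up to second order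
  in \<open>t\<close>, so a contractive functional that is nearly 1 at \<open>x\<close> must be small at \<open>star a * a\<close>
  (lemma \<open>functional_le_of_small_product\<close>).

  Conversely, \<open>norm (a * b)\<close> squared is the value of some contractive positive functional \<open>\<phi>\<close> at
  \<open>star b * (star a * a) * b\<close>. Dividing \<open>\<phi> (star b * _ * b)\<close> by \<open>\<phi> (star b * b)\<close> gives a state, and
  those functionals with \<open>\<phi> (star b * b) \<ge> \<epsilon>\<close> give a weak* compact set of states; the others
  contribute at most \<open>norm a ^ 2 * \<epsilon>\<close> (lemma \<open>norm_mult_right_le_su_seminorm\<close>). The other strict
  seminorms follow by applying the involution.

  The second inclusion needs enough positive functionals, and for these the order theory of
  C*-algebras: an element \<open>star x * x\<close> is positive and the norm is monotone on positive elements.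
  The proofs take place in the unitization and use no spectral theory. Their main tool is
  the square root of a positive element, obtained from an iteration; the norm estimates then come
  from the unitaries \<open>h + scaleC \<i> k\<close> with \<open>h * h + k * k = 1\<close>. With monotonicity of the norm, the
  Hahn-Banach theorem for the sublinear functional \<open>cone_norm\<close> produces the functional \<open>\<phi>\<close> above.
\<close>

section \<open>The involution and complex scalars\<close>

lemma scaleC_one [simp]: "scaleC 1 x = (x::'a::cstar_algebra)"
  using scaleC_of_real[of 1 x] by simp

lemma scaleC_zero_left [simp]: "scaleC 0 x = (0::'a::cstar_algebra)"
  using scaleC_of_real[of 0 x] by simp

lemma scaleC_zero_right [simp]: "scaleC c (0::'a::cstar_algebra) = 0"
  using norm_scaleC[of c "0::'a"] by simp

lemma scaleC_minus_right: "scaleC c (- x) = - scaleC c (x::'a::cstar_algebra)"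
  using scaleC_add_right[of c x "- x"] by (simp add: eq_neg_iff_add_eq_0 add.commute)

lemma scaleC_minus_left: "scaleC (- c) x = - scaleC c (x::'a::cstar_algebra)"
  using scaleC_add_left[of c "- c" x] by (simp add: eq_neg_iff_add_eq_0 add.commute)

lemma scaleC_diff_right: "scaleC c (x - y) = scaleC c x - scaleC c (y::'a::cstar_algebra)"
  using scaleC_add_right[of c x "- y"] by (simp add: scaleC_minus_right)

lemma scaleR_scaleC: "scaleR r (scaleC c x) = scaleC (of_real r * c) (x::'a::cstar_algebra)"
  by (simp add: scaleC_of_real[symmetric] scaleC_scaleC)

lemma scaleC_scaleR: "scaleC c (scaleR r x) = scaleC (c * of_real r) (x::'a::cstar_algebra)"
  by (simp add: scaleC_of_real[symmetric] scaleC_scaleC)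

lemma star_zero [simp]: "star (0::'a::cstar_algebra) = 0"
  using star_add[of "0::'a" 0] by simp

lemma star_minus: "star (- x) = - star (x::'a::cstar_algebra)"
  using star_add[of x "- x"] by (simp add: eq_neg_iff_add_eq_0 add.commute)

lemma star_diff: "star (x - y) = star x - star (y::'a::cstar_algebra)"
  using star_add[of x "- y"] by (simp add: star_minus)

lemma star_scaleR: "star (scaleR r x) = scaleR r (star (x::'a::cstar_algebra))"
  using star_scaleC[of "of_real r" x] by (simp add: scaleC_of_real)

lemma norm_star [simp]: "norm (star x) = norm (x::'a::cstar_algebra)"
proof -
  have le: "norm y \<le> norm (star y)" for y :: 'a
  proof (cases "y = 0")
    case False
    have "norm y * norm y \<le> norm (star y) * norm y"
      using norm_mult_ineq[of "star y" y] by (simp add: cstar_identity power2_eq_square)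
    then show ?thesis using False by simp
  qed simp
  show ?thesis using le[of x] le[of "star x"] by (simp add: star_star)
qed

lemma norm_mult_star: "norm (x * star x) = (norm (x::'a::cstar_algebra))\<^sup>2"
  using cstar_identity[of "star x"] by (simp add: star_star)

lemma bounded_linear_star: "bounded_linear (star :: 'a::cstar_algebra \<Rightarrow> 'a)"
  by (rule bounded_linear_intro[of _ 1]) (simp_all add: star_add star_scaleR)

section \<open>The unitization\<close>

datatype 'a unitization = Unitization (elem_part: 'a) (scalar_part: complex)

lemma unitization_eq_iff:
  "x = y \<longleftrightarrow> elem_part x = elem_part y \<and> scalar_part x = scalar_part y"
  by (cases x; cases y) simp

instantiation unitization :: (cstar_algebra) real_vector
begin

definition "0 = Unitization 0 0"
definition "x + y = Unitization (elem_part x + elem_part y) (scalar_part x + scalar_part y)"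
definition "x - y = Unitization (elem_part x - elem_part y) (scalar_part x - scalar_part y)"
definition "- x = Unitization (- elem_part x) (- scalar_part x)"
definition "r *\<^sub>R x = Unitization (r *\<^sub>R elem_part x) (r *\<^sub>R scalar_part x)"

instance
  by standard
    (simp_all add: unitization_eq_iff zero_unitization_def plus_unitization_def
      minus_unitization_def uminus_unitization_def scaleR_unitization_def algebra_simps)

end

instantiation unitization :: (cstar_algebra) ring_1
begin

definition "1 = Unitization 0 1"
definition "x * y = Unitization
   (elem_part x * elem_part y + scaleC (scalar_part x) (elem_part y)
     + scaleC (scalar_part y) (elem_part x))
   (scalar_part x * scalar_part y)"

instance
  by standard
    (simp_all add: unitization_eq_iff zero_unitization_def plus_unitization_def
      one_unitization_def times_unitization_def algebra_simps scaleC_add_left scaleC_add_right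
      scaleC_scaleC mult_scaleC_left mult_scaleC_right)

end

lemma unitization_simps [simp]:
  "elem_part 0 = 0" "scalar_part 0 = 0"
  "elem_part (1::'a::cstar_algebra unitization) = 0"
  "scalar_part (1::'a::cstar_algebra unitization) = 1"
  "elem_part (x + y) = elem_part x + elem_part y"
  "scalar_part (x + y) = scalar_part x + scalar_part y"
  "elem_part (x - y) = elem_part x - elem_part y"
  "scalar_part (x - y) = scalar_part x - scalar_part y"
  "elem_part (- x) = - elem_part x"
  "scalar_part (- x) = - scalar_part x"
  "elem_part (r *\<^sub>R x) = r *\<^sub>R elem_part x"
  "scalar_part (r *\<^sub>R x) = r *\<^sub>R scalar_part x"
  "elem_part (x * y) = elem_part x * elem_part y + scaleC (scalar_part x) (elem_part y)
     + scaleC (scalar_part y) (elem_part x)"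
  "scalar_part (x * y) = scalar_part x * scalar_part y"
  for x y :: "'a::cstar_algebra unitization"
  by (simp_all add: zero_unitization_def one_unitization_def plus_unitization_def
      minus_unitization_def uminus_unitization_def scaleR_unitization_def times_unitization_def)

text \<open>
  The unitization acts by multiplication on \<open>'a\<close>, which sits in it as an ideal.
\<close>

definition action :: "'a::cstar_algebra unitization \<Rightarrow> 'a \<Rightarrow> 'a" where
  "action u y = elem_part u * y + scaleC (scalar_part u) y"

lemma bounded_linear_scaleC: "bounded_linear (scaleC c :: 'a::cstar_algebra \<Rightarrow> 'a)"
  by (rule bounded_linear_intro[of _ "cmod c"])
    (simp_all add: scaleC_add_right scaleC_scaleR scaleR_scaleC norm_scaleC mult.commute)

lemma bounded_linear_action [intro, simp]: "bounded_linear (action u)"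
  unfolding action_def
  by (intro bounded_linear_add bounded_linear_mult_right bounded_linear_scaleC)

lemma action_add: "action (u + v) y = action u y + action v y"
  by (simp add: action_def scaleC_add_left algebra_simps)

lemma action_scaleR: "action (r *\<^sub>R u) y = r *\<^sub>R action u y"
  by (simp add: action_def scaleR_scaleC scaleR_conv_of_real algebra_simps)

lemma action_mult: "action (u * v) y = action u (action v y)"
  by (simp add: action_def scaleC_add_right scaleC_scaleC mult_scaleC_left mult_scaleC_right
      algebra_simps)

text \<open>
  If \<open>'a\<close> has a unit \<open>e\<close> already, then \<open>Unitization e (-1)\<close> acts as zero, so the operator norm of
  the action alone is only a seminorm. Taking the maximum with the scalar part means embedding the
  unitization in the product of the operators on \<open>'a\<close> with the complex numbers, which has a
  C*-norm whether or not \<open>'a\<close> is unital.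
\<close>

instantiation unitization :: (cstar_algebra) real_normed_vector
begin

definition "norm x = max (onorm (action x)) (cmod (scalar_part x))"
definition "dist x y = norm (x - y)" for x y :: "'a unitization"
definition "sgn x = inverse (norm x) *\<^sub>R x" for x :: "'a unitization"
definition "uniformity = (INF e\<in>{0<..}. principal {(x, y :: 'a unitization). dist x y < e})"
definition "open U = (\<forall>x\<in>U. eventually (\<lambda>(x', y). x' = x \<longrightarrow> y \<in> U) uniformity)"
  for U :: "'a unitization set"

instance
proof
  fix x y :: "'a unitization" and r :: real and U :: "'a unitization set"
  show "dist x y = norm (x - y)" by (rule dist_unitization_def)
  show "sgn x = inverse (norm x) *\<^sub>R x" by (rule sgn_unitization_def)
  show "uniformity = (INF e\<in>{0<..}. principal {(x, y :: 'a unitization). dist x y < e})"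
    by (rule uniformity_unitization_def)
  show "open U \<longleftrightarrow> (\<forall>x\<in>U. eventually (\<lambda>(x', y). x' = x \<longrightarrow> y \<in> U) uniformity)"
    by (rule open_unitization_def)
  show "norm x = 0 \<longleftrightarrow> x = 0"
  proof
    assume "norm x = 0"
    then have s: "scalar_part x = 0" and o: "onorm (action x) = 0"
      unfolding norm_unitization_def using onorm_pos_le[OF bounded_linear_action, of x]
      by (auto simp: max_def split: if_splits)
    have "action x (star (elem_part x)) = 0"
      using onorm[OF bounded_linear_action, of x "star (elem_part x)"] o by simp
    then have "elem_part x = 0"
      using norm_mult_star[of "elem_part x"] s by (simp add: action_def)
    then show "x = 0" using s by (simp add: unitization_eq_iff)
  next
    assume "x = 0"
    then have "action x = (\<lambda>_. 0)" by (auto simp: action_def)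
    then show "norm x = 0" using \<open>x = 0\<close> by (simp add: norm_unitization_def onorm_zero)
  qed
  show "norm (x + y) \<le> norm x + norm y"
  proof -
    have "onorm (action (x + y)) \<le> onorm (action x) + onorm (action y)"
      using onorm_triangle[OF bounded_linear_action bounded_linear_action, of x y]
      by (simp add: action_add[abs_def])
    moreover have "cmod (scalar_part x + scalar_part y) \<le> cmod (scalar_part x) + cmod (scalar_part y)"
      by (rule norm_triangle_ineq)
    ultimately show ?thesis unfolding norm_unitization_def unitization_simps by linarith
  qed
  show "norm (r *\<^sub>R x) = \<bar>r\<bar> * norm x"
  proof -
    have "onorm (action (r *\<^sub>R x)) = \<bar>r\<bar> * onorm (action x)"
      using onorm_scaleR[OF bounded_linear_action, of r x]
      by (simp add: action_scaleR[abs_def])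
    then show ?thesis unfolding norm_unitization_def by (simp add: max_mult_distrib_left)
  qed
qed

end

lemma norm_action_le: "norm (action u y) \<le> norm u * norm y"
proof -
  have "norm (action u y) \<le> onorm (action u) * norm y" by (rule onorm) simp
  also have "\<dots> \<le> norm u * norm y"
    by (intro mult_right_mono) (simp_all add: norm_unitization_def)
  finally show ?thesis .
qed

lemma norm_unitization_le:
  assumes "\<And>y. norm (action u y) \<le> c * norm y" "cmod (scalar_part u) \<le> c"
  shows "norm u \<le> c"
proof -
  have "0 \<le> c" using assms(2) norm_ge_zero order_trans by blast
  then show ?thesis
    using onorm_bound[of c "action u"] assms unfolding norm_unitization_def by simp
qed

lemma cmod_scalar_part_le: "cmod (scalar_part u) \<le> norm u"
  by (simp add: norm_unitization_def)

instance unitization :: (cstar_algebra) real_normed_algebra_1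
proof
  fix x y :: "'a unitization" and a :: real
  show "a *\<^sub>R x * y = a *\<^sub>R (x * y)" "x * a *\<^sub>R y = a *\<^sub>R (x * y)"
    by (simp_all add: unitization_eq_iff scaleR_scaleC scaleC_scaleR algebra_simps)
       (simp_all add: scaleR_conv_of_real algebra_simps)
  show "norm (x * y) \<le> norm x * norm y"
  proof (rule norm_unitization_le)
    fix z
    have "norm (action (x * y) z) \<le> norm x * norm (action y z)"
      by (simp add: action_mult norm_action_le)
    also have "\<dots> \<le> norm x * (norm y * norm z)"
      by (intro mult_left_mono norm_action_le) simp
    finally show "norm (action (x * y) z) \<le> norm x * norm y * norm z" by simp
  next
    show "cmod (scalar_part (x * y)) \<le> norm x * norm y"
      by (simp add: norm_mult mult_mono cmod_scalar_part_le)
  qed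
  have "norm (1::'a unitization) \<le> 1"
    by (rule norm_unitization_le) (simp_all add: action_def)
  moreover have "1 \<le> norm (1::'a unitization)"
    using cmod_scalar_part_le[of "1::'a unitization"] by simp
  ultimately show "norm (1::'a unitization) = 1" by simp
qed

lemma norm_Unitization_le: "norm (Unitization a c) \<le> norm a + cmod c"
proof (rule norm_unitization_le)
  fix y
  show "norm (action (Unitization a c) y) \<le> (norm a + cmod c) * norm y"
    using norm_triangle_ineq[of "a * y" "scaleC c y"] norm_mult_ineq[of a y]
    by (simp add: action_def norm_scaleC algebra_simps)
qed simp

text \<open>
  The embedding is isometric because left multiplication by \<open>a\<close> attains its norm at \<open>star a\<close>.
\<close>

lemma norm_Unitization_0 [simp]: "norm (Unitization a 0) = norm a"
proof (rule antisym)
  show "norm (Unitization a 0) \<le> norm a" using norm_Unitization_le[of a 0] by simp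
  show "norm a \<le> norm (Unitization a 0)"
  proof (cases "a = 0")
    case False
    have "norm a * norm a \<le> norm (Unitization a 0) * norm a"
      using norm_action_le[of "Unitization a 0" "star a"] norm_mult_star[of a]
      by (simp add: action_def power2_eq_square)
    then show ?thesis using False by simp
  qed simp
qed

lemma norm_elem_part_le: "norm (elem_part u) \<le> 2 * norm u"
  for u :: "'a::cstar_algebra unitization"
proof -
  have "Unitization (elem_part u) 0 = u - Unitization 0 (scalar_part u)"
    by (simp add: unitization_eq_iff)
  then have "norm (elem_part u) \<le> norm u + norm (Unitization (0::'a) (scalar_part u))"
    using norm_triangle_ineq4 norm_Unitization_0 by metis
  also have "\<dots> \<le> 2 * norm u"
    using norm_Unitization_le[of "0::'a" "scalar_part u"] cmod_scalar_part_le[of u] by simp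
  finally show ?thesis .
qed

text \<open>
  Both coordinates are bounded linear maps, so a Cauchy sequence converges in each of them.
\<close>

instance unitization :: (cstar_algebra) banach
proof
  fix X :: "nat \<Rightarrow> 'a unitization" assume X: "Cauchy X"
  have bl: "bounded_linear (elem_part :: 'a unitization \<Rightarrow> 'a)"
    by (rule bounded_linear_intro[of _ 2]) (use norm_elem_part_le in \<open>simp_all add: mult.commute\<close>)
  have bl': "bounded_linear (scalar_part :: 'a unitization \<Rightarrow> complex)"
    by (rule bounded_linear_intro[of _ 1]) (simp_all add: cmod_scalar_part_le)
  obtain a where a: "(\<lambda>n. elem_part (X n)) \<longlonglongrightarrow> a"
    using bounded_linear.Cauchy[OF bl X] Cauchy_convergent convergent_def by blast
  obtain c where c: "(\<lambda>n. scalar_part (X n)) \<longlonglongrightarrow> c"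
    using bounded_linear.Cauchy[OF bl' X] Cauchy_convergent convergent_def by blast
  have "(\<lambda>n. norm (elem_part (X n) - a) + cmod (scalar_part (X n) - c)) \<longlonglongrightarrow> 0"
    using tendsto_add[OF tendsto_norm[OF LIM_zero[OF a]] tendsto_norm[OF LIM_zero[OF c]]] by simp
  moreover have "norm (X n - Unitization a c)
      \<le> norm (elem_part (X n) - a) + cmod (scalar_part (X n) - c)" for n
    using norm_Unitization_le[of "elem_part (X n) - a" "scalar_part (X n) - c"]
    by (simp add: minus_unitization_def)
  ultimately have "(\<lambda>n. X n - Unitization a c) \<longlonglongrightarrow> 0"
    by (rule_tac Lim_null_comparison[rotated]) auto
  then show "convergent X" unfolding convergent_def using LIM_zero_cancel by blast
qed

instantiation unitization :: (cstar_algebra) cstar_algebra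
begin

definition "scaleC c x = Unitization (scaleC c (elem_part x)) (c * scalar_part x)"
definition "star x = Unitization (star (elem_part x)) (cnj (scalar_part x))"

lemma unitization_star_simps [simp]:
  "elem_part (scaleC c x) = scaleC c (elem_part x)"
  "scalar_part (scaleC c x) = c * scalar_part x"
  "elem_part (star x) = star (elem_part x)"
  "scalar_part (star x) = cnj (scalar_part x)" for x :: "'a unitization"
  by (simp_all add: scaleC_unitization_def star_unitization_def)

instance
proof
  fix x y :: "'a unitization" and c d :: complex and r :: real
  show "scaleC (complex_of_real r) x = r *\<^sub>R x"
    by (simp add: unitization_eq_iff scaleC_of_real) (simp add: scaleR_conv_of_real)
  show "scaleC c (x + y) = scaleC c x + scaleC c y"
    "scaleC (c + d) x = scaleC c x + scaleC d x"
    "scaleC c (scaleC d x) = scaleC (c * d) x"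
    "scaleC c x * y = scaleC c (x * y)"
    "x * scaleC c y = scaleC c (x * y)"
    "star (star x) = x"
    "star (x + y) = star x + star y"
    "star (scaleC c x) = scaleC (cnj c) (star x)"
    "star (x * y) = star y * star x"
    by (simp_all add: unitization_eq_iff scaleC_add_left scaleC_add_right scaleC_scaleC
        mult_scaleC_left mult_scaleC_right star_star star_add star_scaleC star_mult algebra_simps)
  have le: "norm (scaleC c x) \<le> cmod c * norm x" for c and x :: "'a unitization"
  proof (rule norm_unitization_le)
    fix z
    have "action (scaleC c x) z = scaleC c (action x z)"
      by (simp add: action_def scaleC_add_right scaleC_scaleC mult_scaleC_left)
    then show "norm (action (scaleC c x) z) \<le> cmod c * norm x * norm z"
      using mult_left_mono[OF norm_action_le[of x z], of "cmod c"] by (simp add: norm_scaleC mult.assoc)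
  qed (simp add: norm_mult mult_left_mono cmod_scalar_part_le)
  show "norm (scaleC c x) = cmod c * norm x"
  proof (cases "c = 0")
    case True then show ?thesis using le[of c x] by simp
  next
    case False
    have "scaleC (inverse c) (scaleC c x) = x"
      using False by (simp add: unitization_eq_iff scaleC_scaleC)
    then have "norm x \<le> cmod (inverse c) * norm (scaleC c x)"
      using le[of "inverse c" "scaleC c x"] by simp
    then have "cmod c * norm x \<le> norm (scaleC c x)"
      using False by (simp add: norm_inverse norm_divide field_simps)
    then show ?thesis using le[of c x] by simp
  qed
  \<comment> \<open>The action of \<open>star u\<close> is adjoint to that of \<open>u\<close> for the form \<open>star y * z\<close> with values in
    \<open>'a\<close>; the C*-identity of \<open>'a\<close> then passes to the operator norm as it does on a Hilbert space.\<close>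
  have adj: "star (action u y) * action u z = star y * action (star u * u) z"
    for u :: "'a unitization" and y z
    by (simp add: action_def star_add star_mult star_scaleC scaleC_add_right scaleC_scaleC
        mult_scaleC_left mult_scaleC_right algebra_simps)
  have sq: "(norm u)\<^sup>2 \<le> norm (star u * u)" for u :: "'a unitization"
  proof -
    have "norm u \<le> sqrt (norm (star u * u))"
    proof (rule norm_unitization_le)
      fix z
      have "(norm (action u z))\<^sup>2 = norm (star z * action (star u * u) z)"
        by (simp add: cstar_identity[symmetric] adj)
      also have "\<dots> \<le> norm z * (norm (star u * u) * norm z)"
        using norm_mult_ineq[of "star z" "action (star u * u) z"]
          mult_left_mono[OF norm_action_le[of "star u * u" z], of "norm z"] by simp
      also have "\<dots> = (sqrt (norm (star u * u)) * norm z)\<^sup>2"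
        by (simp add: power_mult_distrib power2_eq_square)
      finally show "norm (action u z) \<le> sqrt (norm (star u * u)) * norm z"
        by (rule power2_le_imp_le) simp
    next
      have "(cmod (scalar_part u))\<^sup>2 \<le> norm (star u * u)"
        using cmod_scalar_part_le[of "star u * u"] by (simp add: norm_mult power2_eq_square)
      then show "cmod (scalar_part u) \<le> sqrt (norm (star u * u))"
        by (rule real_le_rsqrt)
    qed
    then show ?thesis
      using power_mono[of "norm u" "sqrt (norm (star u * u))" 2] by simp
  qed
  have star_star': "star (star u) = u" for u :: "'a unitization"
    by (simp add: unitization_eq_iff star_star)
  have ns: "norm u \<le> norm (star u)" for u :: "'a unitization"
  proof (cases "u = 0")
    case False
    have "norm u * norm u \<le> norm (star u) * norm u"
      using sq[of u] norm_mult_ineq[of "star u" u] by (simp add: power2_eq_square)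
    then show ?thesis using False by simp
  qed simp
  have "norm (star x) = norm x" using ns[of x] ns[of "star x"] star_star'[of x] by simp
  then show "norm (star x * x) = (norm x)\<^sup>2"
    using sq[of x] norm_mult_ineq[of "star x" x] by (simp add: power2_eq_square)
qed

end

section \<open>Positive elements of a unital C*-algebra\<close>

lemma star_one [simp]: "star (1::'a::{cstar_algebra,real_normed_algebra_1}) = 1"
  using star_mult[of "star 1" "1::'a"] by (simp add: star_star)

lemma star_of_real [simp]:
  "star (of_real r) = (of_real r :: 'a::{cstar_algebra,real_normed_algebra_1})"
  by (simp add: of_real_def star_scaleR)

lemma star_power: "star (x ^ n) = star (x::'a::{cstar_algebra,real_normed_algebra_1}) ^ n"
  by (induction n) (simp_all add: star_mult power_commutes)

text \<open>
  For self-adjoint \<open>h\<close> and real \<open>t\<close>, the bound \<open>norm (of_real t - h) \<le> t\<close> says that the spectrum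
  of \<open>h\<close> lies in the interval from \<open>0\<close> to \<open>2 * t\<close>. In this form positivity needs no spectral
  theory and is evidently stable under sums, which for the condition \<open>\<exists>x. h = star x * x\<close> is the
  hard part.
\<close>

definition positive :: "'a::{cstar_algebra,real_normed_algebra_1} \<Rightarrow> bool" where
  "positive h \<longleftrightarrow> star h = h \<and> (\<exists>t. norm (of_real t - h) \<le> t)"

lemma positiveI: "star h = h \<Longrightarrow> norm (of_real t - h) \<le> t \<Longrightarrow> positive h"
  by (auto simp: positive_def)

lemma mult_of_real:
  "x * of_real r = r *\<^sub>R (x::'a::real_algebra_1)" "of_real r * x = r *\<^sub>R x"
  by (simp_all add: of_real_def)

lemma norm_of_real_diff_mono:
  fixes h :: "'a::{cstar_algebra,real_normed_algebra_1}"
  assumes "norm (of_real t - h) \<le> t" "t \<le> s"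
  shows "norm (of_real s - h) \<le> s"
proof -
  have "of_real s - h = of_real (s - t) + (of_real t - h)" by simp
  then have "norm (of_real s - h) \<le> \<bar>s - t\<bar> + t"
    using norm_triangle_ineq[of "of_real (s - t)" "of_real t - h"] assms
    by (metis add_left_mono norm_of_real order_trans)
  then show ?thesis using assms by simp
qed

lemma positive_obtain:
  assumes "positive h"
  obtains t where "t > 0" "norm (of_real t - h) \<le> t"
proof -
  obtain t where "norm (of_real t - h) \<le> t" using assms by (auto simp: positive_def)
  then have "norm (of_real (max t 1) - h) \<le> max t 1" by (rule norm_of_real_diff_mono) simp
  then show ?thesis using that[of "max t 1"] by simp
qed

lemma positive_self_adjoint: "positive h \<Longrightarrow> star h = h"
  by (simp add: positive_def)

lemma positive_add:
  assumes "positive h" "positive k"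
  shows "positive (h + k)"
proof -
  obtain t s where ts: "norm (of_real t - h) \<le> t" "norm (of_real s - k) \<le> s"
    using assms by (auto simp: positive_def)
  have "of_real (t + s) - (h + k) = (of_real t - h) + (of_real s - k)" by simp
  then have "norm (of_real (t + s) - (h + k)) \<le> t + s"
    using ts norm_triangle_mono by metis
  then show ?thesis using assms by (intro positiveI[of _ "t + s"]) (simp_all add: star_add positive_def)
qed

lemma positive_scaleR:
  assumes "positive h" "r \<ge> 0"
  shows "positive (r *\<^sub>R h)"
proof -
  obtain t where t: "norm (of_real t - h) \<le> t" using assms by (auto simp: positive_def)
  have "of_real (r * t) - r *\<^sub>R h = r *\<^sub>R (of_real t - h)"
    by (simp add: of_real_def algebra_simps)
  then have "norm (of_real (r * t) - r *\<^sub>R h) \<le> r * t"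
    using t assms by (simp add: mult_left_mono)
  then show ?thesis using assms by (intro positiveI[of _ "r * t"]) (simp_all add: star_scaleR positive_def)
qed

lemma positive_of_real: "r \<ge> 0 \<Longrightarrow> positive (of_real r)"
  unfolding positive_def by (auto intro: exI[of _ r])

lemma positive_norm_diff: "star g = g \<Longrightarrow> positive (of_real (norm g) - g)"
  unfolding positive_def by (auto simp: star_diff intro!: exI[of _ "norm g"])

lemma positive_of_real_diff:
  assumes "star g = g" "norm g \<le> r"
  shows "positive (of_real r - g)"
proof -
  have "of_real r - g = of_real (r - norm g) + (of_real (norm g) - g)" by simp
  then show ?thesis
    using positive_add[OF positive_of_real[of "r - norm g"] positive_norm_diff[of g]] assms by simp
qed

text \<open>
  The element \<open>y = 1 - sqrt (1 - x)\<close> is a fixed point of \<open>y \<mapsto> (x + y * y) / 2\<close>. Started at \<open>0\<close>,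
  the iteration is majorized, increments included, by the same iteration for the number
  \<open>norm x\<close>. The scalar iteration is increasing and bounded by \<open>1\<close>, hence it converges also in the
  boundary case \<open>norm x = 1\<close>, where the iteration is no contraction.
\<close>

lemma sqrt_one_minus:
  fixes x :: "'a::{cstar_algebra,real_normed_algebra_1}"
  assumes x: "star x = x" "norm x \<le> 1"
  obtains y where "star y = y" "norm y \<le> 1" "(1 - y) * (1 - y) = 1 - x"
    "\<And>w. w * x = x * w \<Longrightarrow> w * y = y * w"
proof -
  define Y where "Y = rec_nat (0::'a) (\<lambda>_ y. (1/2) *\<^sub>R (x + y * y))"
  define s where "s = rec_nat (0::real) (\<lambda>_ y. (norm x + y * y) / 2)"
  have Y: "Y 0 = 0" "Y (Suc n) = (1/2) *\<^sub>R (x + Y n * Y n)" for n by (simp_all add: Y_def)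
  have s: "s 0 = 0" "s (Suc n) = (norm x + s n * s n) / 2" for n by (simp_all add: s_def)
  have s01: "0 \<le> s n \<and> s n \<le> 1" for n
  proof (induction n)
    case (Suc n)
    then have "s n * s n \<le> 1" by (simp add: mult_le_one)
    then show ?case using x by (simp add: s)
  qed (simp add: s)
  have Ys: "norm (Y n) \<le> s n" for n
  proof (induction n)
    case (Suc n)
    have "norm (x + Y n * Y n) \<le> norm x + s n * s n"
      using norm_triangle_ineq[of x "Y n * Y n"] norm_mult_ineq[of "Y n" "Y n"]
        mult_mono[OF Suc Suc] s01[of n] by simp
    then show ?case by (simp add: Y s)
  qed (simp add: Y s)
  \<comment> \<open>The factors are kept in order, since \<open>y * y - z * z = y * (y - z) + (y - z) * z\<close> holds without
    commutativity.\<close>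
  have dYs: "norm (Y (Suc n) - Y n) \<le> s (Suc n) - s n" for n
  proof (induction n)
    case 0
    then show ?case by (simp add: Y s)
  next
    case (Suc n)
    let ?d = "Y (Suc n) - Y n" and ?e = "s (Suc n) - s n"
    have e: "?e \<ge> 0" using Suc norm_ge_zero order_trans by blast
    have "Y (Suc (Suc n)) - Y (Suc n) = (1/2) *\<^sub>R (Y (Suc n) * ?d + ?d * Y n)"
      unfolding Y(2)[of "Suc n"] by (subst (3) Y(2)) (simp add: algebra_simps)
    moreover have "norm (Y (Suc n) * ?d) \<le> s (Suc n) * ?e"
      using norm_mult_ineq[of "Y (Suc n)" ?d] mult_mono[OF Ys[of "Suc n"] Suc] s01[of "Suc n"] by simp
    moreover have "norm (?d * Y n) \<le> ?e * s n"
      using norm_mult_ineq[of ?d "Y n"] mult_mono[OF Suc Ys[of n]] e by simp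
    ultimately have "norm (Y (Suc (Suc n)) - Y (Suc n)) \<le> (s (Suc n) * ?e + ?e * s n) / 2"
      using norm_triangle_ineq[of "Y (Suc n) * ?d" "?d * Y n"] by simp
    also have "\<dots> = s (Suc (Suc n)) - s (Suc n)"
    proof -
      have "s (Suc n) * ?e + ?e * s n = s (Suc n) * s (Suc n) - s n * s n"
        by (simp add: algebra_simps)
      moreover have "C / 2 = P - Q"
        if "P = (c + A) / 2" "Q = (c + B) / 2" "C = A - B" for A B C P Q c :: real
        using that by (simp add: field_simps)
      ultimately show ?thesis using s(2)[of "Suc n"] s(2)[of n] by blast
    qed
    finally show ?case .
  qed
  have inc: "incseq s"
  proof (rule incseq_SucI)
    fix n show "s n \<le> s (Suc n)" using dYs[of n] norm_ge_zero[of "Y (Suc n) - Y n"] by linarith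
  qed
  obtain S where S: "s \<longlonglongrightarrow> S" using incseq_convergent[OF inc, of 1] s01 by blast
  have "summable (\<lambda>n. s (Suc n) - s n)" by (rule telescope_summable[OF S])
  then have "summable (\<lambda>n. Y (Suc n) - Y n)"
    by (rule summable_comparison_test'[where N = 0]) (use dYs in auto)
  then have "(\<lambda>n. \<Sum>k<n. Y (Suc k) - Y k) \<longlonglongrightarrow> (\<Sum>n. Y (Suc n) - Y n)"
    by (rule summable_LIMSEQ)
  moreover have "(\<Sum>k<n. Y (Suc k) - Y k) = Y n" for n
    using sum_lessThan_telescope[of Y n] by (simp add: Y)
  ultimately obtain y where y: "Y \<longlonglongrightarrow> y" by auto
  have "Y n * w = w * Y n" if "w * x = x * w" for n w
  proof (induction n)
    case (Suc n)
    have "Y n * Y n * w = w * (Y n * Y n)" by (metis Suc mult.assoc)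
    then show ?case using that by (simp add: Y distrib_left distrib_right)
  qed (simp add: Y)
  then have comm: "w * y = y * w" if "w * x = x * w" for w
    using LIMSEQ_unique[OF tendsto_mult[OF tendsto_const[of w] y], of "y * w"]
      tendsto_mult[OF y tendsto_const[of w]] that by simp
  have "star (Y n) = Y n" for n
    by (induction n) (simp_all add: Y star_scaleR star_add star_mult x)
  then have sa: "star y = y"
    using LIMSEQ_unique[OF bounded_linear.tendsto[OF bounded_linear_star y]] y by simp
  have "norm (Y n) \<le> 1" for n using Ys[of n] s01[of n] by linarith
  then have n1: "norm y \<le> 1" using tendsto_norm[OF y] by (auto intro: LIMSEQ_le_const2)
  have "(\<lambda>n. Y (Suc n)) \<longlonglongrightarrow> (1/2) *\<^sub>R (x + y * y)"
    unfolding Y by (intro tendsto_intros y)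
  then have "y = (1/2) *\<^sub>R (x + y * y)" using LIMSEQ_Suc[OF y] LIMSEQ_unique by blast
  then have "2 *\<^sub>R y = x + y * y" by (metis scaleR_half_double scaleR_2 scaleR_scaleR scaleR_left_commute)
  then have "(1 - y) * (1 - y) = 1 - x" by (simp add: algebra_simps scaleR_2)
  then show ?thesis using that sa n1 comm by blast
qed

lemma positive_sqrt:
  assumes "positive h"
  obtains k where "positive k" "k * k = h" "\<And>w. w * h = h * w \<Longrightarrow> w * k = k * w"
proof -
  obtain t where t: "t > 0" "norm (of_real t - h) \<le> t" using assms positive_obtain by blast
  define x where "x = 1 - (1/t) *\<^sub>R h"
  have tx: "(1/t) *\<^sub>R (of_real t - h) = x"
    using t by (simp add: x_def of_real_def scaleR_diff_right)
  have "star x = x" using positive_self_adjoint[OF assms] by (simp add: x_def star_diff star_scaleR)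
  moreover have "norm x \<le> 1" unfolding tx[symmetric] using t by simp
  ultimately obtain y where y: "star y = y" "norm y \<le> 1" "(1 - y) * (1 - y) = 1 - x"
    "\<And>w. w * x = x * w \<Longrightarrow> w * y = y * w" using sqrt_one_minus by metis
  define k where "k = sqrt t *\<^sub>R (1 - y)"
  have "positive (1 - y)" using positive_of_real_diff[of y 1] y by simp
  then have "positive k" unfolding k_def using t by (intro positive_scaleR) auto
  moreover have "k * k = h" using t y(3) by (simp add: k_def x_def)
  moreover have "w * k = k * w" if "w * h = h * w" for w
  proof -
    have "w * x = x * w" using that by (simp add: x_def algebra_simps)
    then show ?thesis using y(4)[of w] by (simp add: k_def algebra_simps)
  qed
  ultimately show ?thesis using that by blast
qed

text \<open>
  The element \<open>h + scaleC \<i> k\<close> is \<open>s\<close> times a unitary, and \<open>h\<close> is its real part.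
\<close>

lemma norm_le_if_sum_squares:
  fixes h k :: "'a::{cstar_algebra,real_normed_algebra_1}"
  assumes "star h = h" "star k = k" "h * k = k * h" "h * h + k * k = of_real (s\<^sup>2)" "s \<ge> 0"
  shows "norm h \<le> s"
proof -
  define u where "u = h + scaleC \<i> k"
  have su: "star u = h - scaleC \<i> k"
    using assms by (simp add: u_def star_add star_scaleC scaleC_minus_left)
  have "star u * u = h * h + k * k"
    unfolding su unfolding u_def using assms(3)
    by (simp add: algebra_simps mult_scaleC_left mult_scaleC_right scaleC_scaleC scaleC_minus_left
        scaleC_diff_right)
  then have "(norm u)\<^sup>2 = s\<^sup>2"
    unfolding cstar_identity[symmetric] using assms by (simp del: of_real_power)
  then have nu: "norm u = s" using assms(5) by (simp add: power2_eq_iff_nonneg)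
  have "2 *\<^sub>R h = u + star u" unfolding su unfolding u_def by (simp add: scaleR_2)
  then have "norm (2 *\<^sub>R h) \<le> norm u + norm (star u)"
    using norm_triangle_ineq[of u "star u"] by simp
  then show ?thesis using nu by simp
qed

text \<open>
  For \<open>norm g \<le> 1\<close> let \<open>k\<close> be the root of \<open>1 - g * g\<close>. Then \<open>g + scaleC \<i> k\<close> is unitary, so
  \<open>norm k \<le> 1\<close>, whence \<open>norm (1 - g * g) = norm (k * k) \<le> 1\<close>, which is positivity of \<open>g * g\<close>.
\<close>

lemma positive_square:
  fixes h :: "'a::{cstar_algebra,real_normed_algebra_1}"
  assumes "star h = h"
  shows "positive (h * h)"
proof -
  have unit: "positive (g * g)" if g: "star g = g" "norm g \<le> 1" for g :: 'a
  proof -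
    have "norm (g * g) \<le> 1"
      using cstar_identity[of g] g by (simp add: power_le_one)
    then obtain y where y: "star y = y" "(1 - y) * (1 - y) = 1 - g * g"
      "\<And>w. w * (g * g) = g * g * w \<Longrightarrow> w * y = y * w"
      using sqrt_one_minus[of "g * g"] g star_mult by metis
    have "g * y = y * g" by (rule y(3)) (simp add: mult.assoc)
    then have "norm (1 - y) \<le> 1"
      by (intro norm_le_if_sum_squares[of _ g 1]) (use g y(1,2) \<open>g * y = y * g\<close> in \<open>simp_all add: star_diff algebra_simps\<close>)
    then have "norm ((1 - y) * (1 - y)) \<le> 1"
      using cstar_identity[of "1 - y"] y by (simp add: star_diff power_le_one)
    then have "norm (of_real 1 - g * g) \<le> 1" using y by simp
    then show ?thesis using g by (intro positiveI[of _ 1]) (simp_all add: star_mult)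
  qed
  show ?thesis
  proof (cases "h = 0")
    case True then show ?thesis using positive_of_real[of 0] by simp
  next
    case False
    define g where "g = (1 / norm h) *\<^sub>R h"
    have "positive (g * g)" by (rule unit) (use assms False in \<open>simp_all add: g_def star_scaleR\<close>)
    then have "positive ((norm h)\<^sup>2 *\<^sub>R (g * g))" by (rule positive_scaleR) simp
    then show ?thesis using False by (simp add: g_def power2_eq_square)
  qed
qed

text \<open>
  The product is the square of the product of the roots, which commute because each root commutes
  with everything that its square commutes with.
\<close>

lemma positive_mult:
  assumes "positive h" "positive k" "h * k = k * h"
  shows "positive (h * k)"
proof -
  obtain r where r: "positive r" "r * r = h" "\<And>w. w * h = h * w \<Longrightarrow> w * r = r * w"
    using positive_sqrt[OF assms(1)] by blast
  obtain s where s: "positive s" "s * s = k" "\<And>w. w * k = k * w \<Longrightarrow> w * s = s * w"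
    using positive_sqrt[OF assms(2)] by blast
  have "r * k = k * r" using r(3)[of k] assms(3) by simp
  then have rs: "r * s = s * r" by (rule s(3))
  have "star (r * s) = r * s"
    using r(1) s(1) by (simp add: star_mult positive_self_adjoint rs)
  then have "positive ((r * s) * (r * s))" by (rule positive_square)
  also have "(r * s) * (r * s) = r * (s * r) * s" by (simp add: mult.assoc)
  also have "\<dots> = (r * r) * (s * s)" unfolding rs[symmetric] by (simp only: mult.assoc)
  also have "\<dots> = h * k" by (simp only: r(2) s(2))
  finally show ?thesis .
qed

text \<open>
  With \<open>h\<close> and \<open>s - h\<close> also \<open>s\<^sup>2 - h * h = s * (s - h) + h * (s - h)\<close> is positive. Its root \<open>k\<close>
  satisfies \<open>h * h + k * k = s\<^sup>2\<close>.
\<close>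

lemma norm_le_of_positive_diff:
  assumes "positive h" "positive (of_real s - h)" "s \<ge> 0"
  shows "norm h \<le> s"
proof -
  have "positive (h * (of_real s - h))"
    by (rule positive_mult[OF assms(1,2)])
      (simp add: left_diff_distrib right_diff_distrib mult_of_real)
  moreover have "positive (s *\<^sub>R (of_real s - h))" using assms by (intro positive_scaleR)
  ultimately have "positive (s *\<^sub>R (of_real s - h) + h * (of_real s - h))"
    using positive_add by blast
  also have "s *\<^sub>R (of_real s - h) + h * (of_real s - h) = of_real (s\<^sup>2) - h * h"
    by (simp add: right_diff_distrib scaleR_diff_right mult_of_real power2_eq_square)
  finally have "positive (of_real (s\<^sup>2) - h * h)" .
  from positive_sqrt[OF this] obtain k where k: "positive k" "k * k = of_real (s\<^sup>2) - h * h"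
     "\<And>w. w * (of_real (s\<^sup>2) - h * h) = (of_real (s\<^sup>2) - h * h) * w \<Longrightarrow> w * k = k * w"
    by blast
  have hk: "h * k = k * h"
    by (rule k(3))
      (simp add: left_diff_distrib right_diff_distrib mult_of_real mult.assoc
        del: of_real_power)
  then show ?thesis
    by (intro norm_le_if_sum_squares[of h k s])
      (use k(1,2) hk assms in \<open>simp_all add: positive_self_adjoint\<close>)
qed

lemma norm_mono_positive:
  assumes "positive h" "positive k"
  shows "norm h \<le> norm (h + k)"
proof (rule norm_le_of_positive_diff[OF assms(1)])
  have "star (h + k) = h + k" using assms by (simp add: star_add positive_self_adjoint)
  then have "positive ((of_real (norm (h + k)) - (h + k)) + k)"
    by (intro positive_add positive_norm_diff assms(2))
  then show "positive (of_real (norm (h + k)) - h)" by simp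
qed simp

lemma positive_power:
  assumes "positive h"
  shows "positive (h ^ n)"
proof (induction n)
  case 0 then show ?case using positive_of_real[of 1] by simp
next
  case (Suc n)
  then show ?case using positive_mult[OF assms Suc] by (simp add: power_commutes)
qed

lemma self_adjoint_square_zero:
  fixes h :: "'a::cstar_algebra"
  assumes "star h = h" "h * h = 0"
  shows "h = 0"
proof -
  have "(norm h)\<^sup>2 = norm (h * h)" using cstar_identity[of h] unfolding assms(1) by (rule sym)
  then show ?thesis using assms(2) by simp
qed

text \<open>
  Let \<open>p = - star z * z\<close> and \<open>q = z * star z\<close>. The sum of \<open>star z * z\<close> and \<open>z * star z\<close> is twice the
  sum of the squares of the real and imaginary part of \<open>z\<close>, so \<open>q\<close> is positive together with \<open>p\<close>. Now
  \<open>q * z = - z * p\<close>, hence \<open>z * (1 + p / t) ^ n = (1 - q / t) ^ n * z\<close>. For large \<open>t\<close> the right side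
  stays bounded in \<open>n\<close> because \<open>q\<close> is positive, while the left side grows because \<open>p\<close> is positive,
  unless \<open>p = 0\<close>. This replaces the usual argument that \<open>star z * z\<close> and \<open>z * star z\<close> have the same
  nonzero spectrum.
\<close>

lemma zero_if_negative_star_mult:
  fixes z :: "'a::{cstar_algebra,real_normed_algebra_1}"
  assumes "positive (- (star z * z))"
  shows "z = 0"
proof -
  define p where "p = - (star z * z)"
  define q where "q = z * star z"
  have p: "positive p" using assms by (simp add: p_def)
  define a where "a = z + star z"
  define b where "b = scaleC \<i> (z - star z)"
  have "star a = a" by (simp add: a_def star_add star_star add.commute)
  then have a: "positive (a * a)" by (rule positive_square)
  have "star b = b"
    by (simp add: b_def star_diff star_star star_scaleC scaleC_minus_left scaleC_diff_right)
  then have b: "positive (b * b)" by (rule positive_square)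
  have bb: "b * b = - ((z - star z) * (z - star z))"
    unfolding b_def by (simp add: mult_scaleC_left mult_scaleC_right scaleC_scaleC scaleC_minus_left)
  have "a * a + b * b = 2 *\<^sub>R (q - p)"
    unfolding bb a_def p_def q_def scaleR_2 by (simp add: distrib_left distrib_right
        left_diff_distrib right_diff_distrib)
  then have "(1/2) *\<^sub>R (a * a + b * b) + p = q" by simp
  moreover have "positive ((1/2) *\<^sub>R (a * a + b * b) + p)"
    by (rule positive_add[OF positive_scaleR[OF positive_add[OF a b]] p]) simp
  ultimately have "positive q" by simp
  then obtain t where t: "t > 0" "norm (of_real t - q) \<le> t" using positive_obtain by blast
  define v where "v = 1 + (1/t) *\<^sub>R p"
  have pv: "p * v = v * p" by (simp add: v_def algebra_simps)
  have pvn: "p * v ^ n = v ^ n * p" for n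
    using power_commuting_commutes[of v p n] pv by simp
  have v: "positive v"
    unfolding v_def using positive_of_real[of 1] t by (intro positive_add positive_scaleR p) auto
  have zv: "z * v = (1/t) *\<^sub>R ((of_real t - q) * z)"
  proof -
    have "z * p = - (q * z)" by (simp add: p_def q_def mult.assoc)
    then show ?thesis using t
      by (simp add: v_def distrib_left left_diff_distrib scaleR_diff_right of_real_def)
  qed
  have bound: "norm (z * v ^ n) \<le> norm z" for n
  proof (induction n)
    case (Suc n)
    have e: "z * v ^ Suc n = (1/t) *\<^sub>R ((of_real t - q) * (z * v ^ n))"
      using zv by (simp add: mult.assoc[symmetric])
    have "norm ((of_real t - q) * (z * v ^ n)) \<le> norm (of_real t - q) * norm (z * v ^ n)"
      by (rule norm_mult_ineq)
    also have "\<dots> \<le> t * norm z" using t by (intro mult_mono Suc) auto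
    finally have "norm ((of_real t - q) * (z * v ^ n)) / t \<le> norm z"
      using t(1) by (simp only: pos_divide_le_eq mult.commute)
    then show ?case unfolding e using t(1) by simp
  qed simp
  \<comment> \<open>Bernoulli's inequality in the order of the algebra; it gives linear growth in \<open>n\<close>.\<close>
  have bernoulli: "positive (v ^ n - 1 - (real n / t) *\<^sub>R p)" for n
  proof (induction n)
    case 0 then show ?case using positive_of_real[of 0] by simp
  next
    case (Suc n)
    let ?F = "v ^ n - 1 - (real n / t) *\<^sub>R p"
    have "v * ?F = ?F * v"
      using pv by (simp add: right_diff_distrib left_diff_distrib power_commutes)
    then have "positive (v * ?F)" by (intro positive_mult v Suc)
    moreover have "positive ((real n / t\<^sup>2) *\<^sub>R (p * p))"
      using p by (intro positive_scaleR positive_square) (simp_all add: positive_self_adjoint)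
    ultimately have "positive (v * ?F + (real n / t\<^sup>2) *\<^sub>R (p * p))" by (rule positive_add)
    also have "v * ?F + (real n / t\<^sup>2) *\<^sub>R (p * p) = v ^ Suc n - 1 - (real (Suc n) / t) *\<^sub>R p"
    proof -
      have vp: "v * p = p + (1/t) *\<^sub>R (p * p)"
        by (simp add: v_def distrib_right)
      have "v * ?F = v ^ Suc n - v - (real n / t) *\<^sub>R (v * p)"
        by (simp add: right_diff_distrib)
      also have "(real n / t) *\<^sub>R (v * p) = (real n / t) *\<^sub>R p + (real n / t\<^sup>2) *\<^sub>R (p * p)"
        unfolding vp by (simp add: scaleR_add_right power2_eq_square)
      finally have "v * ?F + (real n / t\<^sup>2) *\<^sub>R (p * p)
          = v ^ Suc n - (v + (real n / t) *\<^sub>R p)" by (simp add: diff_diff_eq)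
      also have "v + (real n / t) *\<^sub>R p = 1 + (real (Suc n) / t) *\<^sub>R p"
        by (simp add: v_def add_divide_distrib scaleR_add_left)
      finally show ?thesis by (simp add: diff_diff_eq)
    qed
    finally show ?case .
  qed
  have "real n / t * (norm p)\<^sup>2 \<le> (norm z)\<^sup>2" for n
  proof -
    have m: "real (2 * n) / t * (norm p)\<^sup>2 \<le> norm (p * v ^ (2 * n))"
    proof -
      let ?F = "v ^ (2 * n) - 1 - (real (2 * n) / t) *\<^sub>R p"
      have "p * ?F = ?F * p" by (simp add: right_diff_distrib left_diff_distrib pvn)
      then have "positive (p + p * ?F)" by (intro positive_add positive_mult p bernoulli)
      then have "norm ((real (2 * n) / t) *\<^sub>R (p * p))
          \<le> norm ((real (2 * n) / t) *\<^sub>R (p * p) + (p + p * ?F))"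
        using p t by (intro norm_mono_positive positive_scaleR positive_square)
          (simp_all add: positive_self_adjoint)
      moreover have "norm (p * p) = (norm p)\<^sup>2"
        using cstar_identity[of p] p by (simp add: positive_self_adjoint)
      ultimately show ?thesis using t by (simp add: algebra_simps)
    qed
    have "star (z * v ^ n) * (z * v ^ n) = - (p * v ^ (2 * n))"
    proof -
      have "star (z * v ^ n) * (z * v ^ n) = v ^ n * (star z * z) * v ^ n"
        using v by (simp add: star_mult star_power positive_self_adjoint mult.assoc)
      also have "\<dots> = - (v ^ n * p * v ^ n)" by (simp add: p_def)
      also have "\<dots> = - (p * v ^ (2 * n))"
        by (simp add: pvn[symmetric] mult.assoc power_add[symmetric] mult_2)
      finally show ?thesis .
    qed
    then have "norm (p * v ^ (2 * n)) = (norm (z * v ^ n))\<^sup>2"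
      by (metis cstar_identity norm_minus_cancel)
    also have "\<dots> \<le> (norm z)\<^sup>2" using bound[of n] by (intro power_mono) auto
    finally have "real (2 * n) / t * (norm p)\<^sup>2 \<le> (norm z)\<^sup>2" using m by simp
    moreover have "real n / t * (norm p)\<^sup>2 \<le> real (2 * n) / t * (norm p)\<^sup>2"
      using t by (intro mult_right_mono divide_right_mono) auto
    ultimately show ?thesis by linarith
  qed
  then have "real n * ((norm p)\<^sup>2 / t) \<le> (norm z)\<^sup>2" for n by simp
  then have "(norm p)\<^sup>2 / t \<le> 0"
    by (metis not_le reals_Archimedean3)
  then have "p = 0" using t by (simp add: divide_le_0_iff)
  then show ?thesis using cstar_identity[of z] by (simp add: p_def)
qed

text \<open>
  Let \<open>h = star x * x\<close>, let \<open>r\<close> be its absolute value, the root of \<open>h * h\<close>, and \<open>d = r - h\<close>, which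
  is twice the negative part of \<open>h\<close>. From \<open>h * d = - r * d\<close> follows
  \<open>star (x * d) * (x * d) = - r * d * d\<close>, the negative of a positive element. So \<open>x * d = 0\<close>, and
  since \<open>d * d = 2 * r * d\<close> this forces \<open>d = 0\<close>, that is, \<open>h = r\<close>.
\<close>

theorem positive_star_mult:
  fixes x :: "'a::{cstar_algebra,real_normed_algebra_1}"
  shows "positive (star x * x)"
proof -
  define h where "h = star x * x"
  have h: "star h = h" by (simp add: h_def star_mult star_star)
  obtain r where r: "positive r" "r * r = h * h" "\<And>w. w * (h * h) = h * h * w \<Longrightarrow> w * r = r * w"
    using positive_sqrt[OF positive_square[OF h]] by blast
  have hr: "h * r = r * h" by (rule r(3)) (simp add: mult.assoc)
  define d where "d = r - h"
  have d: "star d = d" using h r(1) by (simp add: d_def star_diff positive_self_adjoint)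
  have hd: "h * d = - (r * d)" using hr r(2) by (simp add: d_def algebra_simps)
  have rd: "r * d = d * r" using hr by (simp add: d_def algebra_simps)
  have dd: "d * d = 2 *\<^sub>R (r * d)" using hr r(2) by (simp add: d_def algebra_simps scaleR_2)
  have "r * (d * d) = r * d * d" by (simp only: mult.assoc)
  also have "\<dots> = d * (r * d)" by (simp only: rd mult.assoc)
  finally have drd: "r * (d * d) = d * (r * d)" .
  also have "\<dots> = d * d * r" by (simp only: rd mult.assoc)
  finally have rdd: "r * (d * d) = d * d * r" .
  have "star (x * d) * (x * d) = d * (h * d)" by (simp add: star_mult d h_def mult.assoc)
  also have "\<dots> = - (r * (d * d))" by (simp add: hd drd)
  finally have e: "star (x * d) * (x * d) = - (r * (d * d))" .
  have "positive (r * (d * d))" by (intro positive_mult r(1) positive_square d rdd)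
  then have "x * d = 0" using e by (intro zero_if_negative_star_mult) simp
  then have rdd0: "r * (d * d) = 0" using e by simp
  have "(d * d) * (d * d) = 2 *\<^sub>R (d * (r * (d * d)))"
    by (subst (1) dd) (simp only: rd mult.assoc mult_scaleR_left)
  then have "(d * d) * (d * d) = 0" using rdd0 by simp
  then have "d * d = 0" using d by (intro self_adjoint_square_zero[of "d * d"]) (simp_all add: star_mult)
  then have "d = 0" using d self_adjoint_square_zero by blast
  then show ?thesis using r(1) by (simp add: d_def h_def)
qed

section \<open>Dominated linear functionals\<close>

definition sublinear :: "('a::real_vector \<Rightarrow> real) \<Rightarrow> bool" where
  "sublinear q \<longleftrightarrow> (\<forall>x y. q (x + y) \<le> q x + q y) \<and> (\<forall>r\<ge>0. \<forall>x. q (r *\<^sub>R x) \<le> r * q x)"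

lemma sublinear_add: "sublinear q \<Longrightarrow> q (x + y) \<le> q x + q y"
  and sublinear_scaleR_le: "sublinear q \<Longrightarrow> r \<ge> 0 \<Longrightarrow> q (r *\<^sub>R x) \<le> r * q x"
  by (simp_all add: sublinear_def)

lemma sublinear_zero:
  assumes "sublinear q" shows "q 0 = 0"
  using sublinear_add[OF assms, of 0 0] sublinear_scaleR_le[OF assms, of 0 0] by simp

lemma sublinear_scaleR:
  assumes "sublinear q" "r \<ge> 0"
  shows "q (r *\<^sub>R x) = r * q x"
proof (cases "r = 0")
  case True then show ?thesis using sublinear_zero[OF assms(1)] by simp
next
  case False
  then have "q x \<le> inverse r * q (r *\<^sub>R x)"
    using sublinear_scaleR_le[OF assms(1), of "inverse r" "r *\<^sub>R x"] assms(2) by simp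
  then have "r * q x \<le> q (r *\<^sub>R x)" using False assms(2) by (simp add: field_simps)
  then show ?thesis using sublinear_scaleR_le[OF assms, of x] by simp
qed

lemma sublinear_ge: "sublinear q \<Longrightarrow> - q (- x) \<le> q x"
  using sublinear_add[of q x "- x"] sublinear_zero[of q] by simp

text \<open>
  This is the largest sublinear functional \<open>f\<close> below \<open>q\<close> with \<open>f (- z) \<le> - q z\<close>, so a linear
  functional below it agrees with \<open>q\<close> at \<open>z\<close>. It serves twice: to prescribe the value at a point,
  and to show that a sublinear functional without a smaller one is additive.
\<close>

definition sublinear_shift :: "'a::real_vector \<Rightarrow> ('a \<Rightarrow> real) \<Rightarrow> 'a \<Rightarrow> real" where
  "sublinear_shift z q x = (INF t\<in>{0..}. q (x + t *\<^sub>R z) - t * q z)"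

lemma sublinear_shift_bdd:
  assumes "sublinear q"
  shows "bdd_below ((\<lambda>t. q (x + t *\<^sub>R z) - t * q z) ` {0..})"
proof (rule bdd_belowI2)
  fix t :: real assume "t \<in> {0..}"
  then have "t * q z = q ((x + t *\<^sub>R z) + (- x))" using sublinear_scaleR[OF assms] by simp
  then show "- q (- x) \<le> q (x + t *\<^sub>R z) - t * q z"
    using sublinear_add[OF assms, of "x + t *\<^sub>R z" "- x"] by linarith
qed

lemma sublinear_shift_le:
  "sublinear q \<Longrightarrow> t \<ge> 0 \<Longrightarrow> sublinear_shift z q x \<le> q (x + t *\<^sub>R z) - t * q z"
  unfolding sublinear_shift_def by (rule cINF_lower[OF sublinear_shift_bdd]) auto

lemma sublinear_shift_greatest:
  assumes "\<And>t. t \<ge> 0 \<Longrightarrow> c \<le> q (x + t *\<^sub>R z) - t * q z"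
  shows "c \<le> sublinear_shift z q x"
  unfolding sublinear_shift_def by (rule cINF_greatest) (use assms in auto)

lemma sublinear_sublinear_shift:
  assumes q: "sublinear q"
  shows "sublinear (sublinear_shift z q)"
  unfolding sublinear_def
proof safe
  fix x y
  have "sublinear_shift z q (x + y) - (q (x + t *\<^sub>R z) - t * q z) \<le> sublinear_shift z q y"
    if t: "t \<ge> 0" for t
  proof (rule sublinear_shift_greatest)
    fix s :: real assume s: "s \<ge> 0"
    have "sublinear_shift z q (x + y) \<le> q ((x + y) + (t + s) *\<^sub>R z) - (t + s) * q z"
      using s t by (intro sublinear_shift_le q) auto
    also have "(x + y) + (t + s) *\<^sub>R z = (x + t *\<^sub>R z) + (y + s *\<^sub>R z)"
      by (simp add: algebra_simps)
    also have "q \<dots> \<le> q (x + t *\<^sub>R z) + q (y + s *\<^sub>R z)" by (rule sublinear_add[OF q])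
    finally show "sublinear_shift z q (x + y) - (q (x + t *\<^sub>R z) - t * q z)
        \<le> q (y + s *\<^sub>R z) - s * q z" by (simp add: algebra_simps)
  qed
  then have "sublinear_shift z q (x + y) - sublinear_shift z q y \<le> sublinear_shift z q x"
    by (intro sublinear_shift_greatest) (simp add: algebra_simps)
  then show "sublinear_shift z q (x + y) \<le> sublinear_shift z q x + sublinear_shift z q y" by simp
next
  fix r :: real and x assume r: "r \<ge> 0"
  show "sublinear_shift z q (r *\<^sub>R x) \<le> r * sublinear_shift z q x"
  proof (cases "r = 0")
    case True
    then show ?thesis using sublinear_shift_le[OF q, of 0 z 0] sublinear_zero[OF q] by simp
  next
    case False
    with r have r: "r > 0" by simp
    have "inverse r * sublinear_shift z q (r *\<^sub>R x) \<le> sublinear_shift z q x"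
    proof (rule sublinear_shift_greatest)
      fix t :: real assume t: "t \<ge> 0"
      have "sublinear_shift z q (r *\<^sub>R x) \<le> q (r *\<^sub>R x + (r * t) *\<^sub>R z) - (r * t) * q z"
        using r t by (intro sublinear_shift_le q) auto
      also have "r *\<^sub>R x + (r * t) *\<^sub>R z = r *\<^sub>R (x + t *\<^sub>R z)" by (simp add: algebra_simps)
      also have "q \<dots> = r * q (x + t *\<^sub>R z)" using r by (intro sublinear_scaleR q) simp
      finally show "inverse r * sublinear_shift z q (r *\<^sub>R x) \<le> q (x + t *\<^sub>R z) - t * q z"
        using r by (simp add: field_simps)
    qed
    then show ?thesis using r by (simp add: field_simps)
  qed
qed

text \<open>
  For subadditivity of the infimum the two functionals chosen for \<open>x\<close> and \<open>y\<close> must be replaced by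
  the smaller one; this is where comparability in the chain enters.
\<close>

lemma sublinear_INF_chain:
  assumes p: "\<And>f. f \<in> C \<Longrightarrow> sublinear f \<and> f \<le> p"
    and chain: "\<And>f g. f \<in> C \<Longrightarrow> g \<in> C \<Longrightarrow> f \<le> g \<or> g \<le> f"
    and ne: "C \<noteq> {}"
  shows "sublinear (\<lambda>x. INF f\<in>C. f x)" "\<And>f x. f \<in> C \<Longrightarrow> (INF g\<in>C. g x) \<le> f x"
proof -
  have bdd: "bdd_below ((\<lambda>f. f x) ` C)" for x
  proof (rule bdd_belowI2)
    fix f assume "f \<in> C"
    then have "- f (- x) \<le> f x" "f (- x) \<le> p (- x)"
      using p sublinear_ge by (auto simp: le_fun_def)
    then show "- p (- x) \<le> f x" by linarith
  qed
  show lower: "(INF g\<in>C. g x) \<le> f x" if "f \<in> C" for f x by (rule cINF_lower[OF bdd that])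
  show "sublinear (\<lambda>x. INF f\<in>C. f x)"
    unfolding sublinear_def
  proof safe
    fix x y
    have "(INF f\<in>C. f (x + y)) - f x \<le> (INF g\<in>C. g y)" if f: "f \<in> C" for f
    proof (rule cINF_greatest[OF ne])
      fix g assume g: "g \<in> C"
      obtain h where h: "h \<in> C" "h \<le> f" "h \<le> g" using chain[OF f g] f g by blast
      have "(INF f\<in>C. f (x + y)) \<le> h x + h y"
        using lower[OF h(1), of "x + y"] sublinear_add[of h x y] p[OF h(1)] by linarith
      also have "\<dots> \<le> f x + g y" using h by (intro add_mono) (auto simp: le_fun_def)
      finally show "(INF f\<in>C. f (x + y)) - f x \<le> g y" by simp
    qed
    then have "(INF f\<in>C. f (x + y)) - (INF g\<in>C. g y) \<le> (INF f\<in>C. f x)"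
      by (intro cINF_greatest[OF ne]) (simp add: algebra_simps)
    then show "(INF f\<in>C. f (x + y)) \<le> (INF f\<in>C. f x) + (INF f\<in>C. f y)" by simp
  next
    fix r :: real and x assume r: "r \<ge> 0"
    show "(INF f\<in>C. f (r *\<^sub>R x)) \<le> r * (INF f\<in>C. f x)"
    proof (cases "r = 0")
      case True
      obtain f where "f \<in> C" using ne by blast
      then show ?thesis using lower[of f 0] sublinear_zero[of f] p[of f] True by simp
    next
      case False
      have "inverse r * (INF f\<in>C. f (r *\<^sub>R x)) \<le> (INF f\<in>C. f x)"
      proof (rule cINF_greatest[OF ne])
        fix f assume f: "f \<in> C"
        then show "inverse r * (INF f\<in>C. f (r *\<^sub>R x)) \<le> f x"
          using lower[OF f, of "r *\<^sub>R x"] sublinear_scaleR[of f r x] p[OF f] r False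
          by (simp add: field_simps)
      qed
      then show ?thesis using r False by (simp add: field_simps)
    qed
  qed
qed

lemma minimal_sublinear_exists:
  fixes p :: "'a::real_vector \<Rightarrow> real"
  assumes "sublinear p"
  obtains m where "sublinear m" "m \<le> p" "\<And>f. sublinear f \<Longrightarrow> f \<le> m \<Longrightarrow> f = m"
proof -
  define S where "S = {q. sublinear q \<and> q \<le> p}"
  define r where "r = {(f, g). f \<in> S \<and> g \<in> S \<and> g \<le> f}"
  have F: "Field r = S" by (auto simp: r_def Field_def)
  have "Partial_order r"
    unfolding partial_order_on_def preorder_on_def F
    by (auto simp: r_def refl_on_def antisym_def intro!: transI intro: order_trans)
  moreover have "\<exists>u\<in>Field r. \<forall>a\<in>C. (a, u) \<in> r" if C: "C \<in> Chains r" for C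
  proof (cases "C = {}")
    case True then show ?thesis using assms by (auto simp: F S_def)
  next
    case False
    have CS: "f \<in> S" if "f \<in> C" for f using C that by (auto simp: Chains_def r_def)
    have chain: "f \<le> g \<or> g \<le> f" if "f \<in> C" "g \<in> C" for f g
      using C that by (auto simp: Chains_def r_def)
    have S': "sublinear f \<and> f \<le> p" if "f \<in> C" for f using CS[OF that] by (simp add: S_def)
    let ?u = "\<lambda>x. INF f\<in>C. f x"
    have u: "sublinear ?u" "\<And>f. f \<in> C \<Longrightarrow> ?u \<le> f"
      using sublinear_INF_chain[OF S' chain False] by (auto simp: le_fun_def)
    obtain f where "f \<in> C" using False by blast
    then have "?u \<in> S" using u S' order_trans[of ?u f p] unfolding S_def by blast
    then show ?thesis using u(2) CS unfolding F by (intro bexI[of _ ?u]) (auto simp: r_def)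
  qed
  ultimately obtain m where m: "m \<in> S" "\<forall>a\<in>S. (m, a) \<in> r \<longrightarrow> a = m"
    using Zorns_po_lemma[of r] F by blast
  show ?thesis
  proof (rule that)
    show "sublinear m" "m \<le> p" using m by (auto simp: S_def)
    fix f assume "sublinear f" "f \<le> m"
    then show "f = m" using m order_trans[of f m p] by (auto simp: r_def S_def)
  qed
qed

text \<open>
  By minimality \<open>sublinear_shift y m = m\<close>, and this says \<open>m x \<le> m (x + y) - m y\<close>.
\<close>

lemma minimal_sublinear_linear:
  assumes m: "sublinear m" and min: "\<And>f. sublinear f \<Longrightarrow> f \<le> m \<Longrightarrow> f = m"
  shows "linear m"
proof -
  have add: "m (x + y) = m x + m y" for x y
  proof -
    have "sublinear_shift y m \<le> m"
      using sublinear_shift_le[OF m, of 0 y] by (simp add: le_fun_def)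
    then have "sublinear_shift y m = m" using min sublinear_sublinear_shift[OF m] by blast
    then have "m x \<le> m (x + y) - m y" using sublinear_shift_le[OF m, of 1 y x] by simp
    then show ?thesis using sublinear_add[OF m, of x y] by simp
  qed
  have minus: "m (- x) = - m x" for x
    using add[of x "- x"] sublinear_zero[OF m] by simp
  have "m (r *\<^sub>R x) = r * m x" for r x
  proof (cases "r \<ge> 0")
    case False
    then show ?thesis
      using sublinear_scaleR[OF m, of "- r" x] minus[of "r *\<^sub>R x"] by simp
  qed (rule sublinear_scaleR[OF m])
  then show ?thesis using add by (intro linearI) auto
qed

text \<open>
  The Hahn-Banach theorem, in the form that a sublinear functional is the pointwise maximum of the
  linear functionals below it.
\<close>

theorem sublinear_dominates_linear:
  fixes p :: "'a::real_vector \<Rightarrow> real"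
  assumes p: "sublinear p"
  obtains f where "linear f" "\<And>x. f x \<le> p x" "f z = p z"
proof -
  obtain m where m: "sublinear m" "m \<le> sublinear_shift z p" "\<And>f. sublinear f \<Longrightarrow> f \<le> m \<Longrightarrow> f = m"
    using minimal_sublinear_exists[OF sublinear_sublinear_shift[OF p]] by blast
  have lin: "linear m" by (rule minimal_sublinear_linear[OF m(1,3)])
  have le: "m x \<le> p x" for x
    using m(2) sublinear_shift_le[OF p, of 0 z x] by (auto simp: le_fun_def intro: order_trans)
  have "m (- z) \<le> p 0 - p z"
    using m(2) sublinear_shift_le[OF p, of 1 z "- z"] by (auto simp: le_fun_def intro: order_trans)
  then have "m z = p z" using le[of z] linear_neg[OF lin, of z] sublinear_zero[OF p] by simp
  then show ?thesis using that lin le by blast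
qed

section \<open>Positive functionals\<close>

text \<open>
  A pointwise limit of states may lose norm, so the set of states need not be weak* compact; the
  set of positive functionals of norm at most 1 always is.
\<close>

definition quasi_state_space :: "('a::cstar_algebra \<Rightarrow> complex) set" where
  "quasi_state_space = {\<phi> \<in> dual_space.
     (\<forall>a. \<phi> (star a * a) \<in> \<real>\<^sub>\<ge>\<^sub>0) \<and> (\<forall>a. cmod (\<phi> a) \<le> norm a)}"

lemma quasi_state_space_iff:
  "\<phi> \<in> quasi_state_space \<longleftrightarrow> (\<forall>x y. \<phi> (x + y) = \<phi> x + \<phi> y) \<and> (\<forall>c a. \<phi> (scaleC c a) = c * \<phi> a)
    \<and> (\<forall>a. \<phi> (star a * a) \<in> \<real>\<^sub>\<ge>\<^sub>0) \<and> (\<forall>a. cmod (\<phi> a) \<le> norm a)"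
proof -
  have "bounded_linear \<phi>" if "\<And>x y. \<phi> (x + y) = \<phi> x + \<phi> y" "\<And>c a. \<phi> (scaleC c a) = c * \<phi> a"
    "\<And>a. cmod (\<phi> a) \<le> norm a"
  proof (rule bounded_linear_intro[of _ 1])
    fix r x show "\<phi> (r *\<^sub>R x) = r *\<^sub>R \<phi> x"
      using that(2)[of "of_real r" x] by (simp add: scaleC_of_real scaleR_conv_of_real)
  qed (use that in simp_all)
  moreover have "\<phi> (x + y) = \<phi> x + \<phi> y" if "bounded_linear \<phi>" for x y
    using that by (rule bounded_linear.linear[THEN linear_add])
  ultimately show ?thesis unfolding quasi_state_space_def dual_space_def by blast
qed

abbreviation embed :: "'a::cstar_algebra \<Rightarrow> 'a unitization" where
  "embed a \<equiv> Unitization a 0"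

lemma embed_mult: "embed (a * b) = embed a * embed b"
  and embed_add: "embed (a + b) = embed a + embed b"
  and embed_star: "embed (star a) = star (embed a)"
  and embed_scaleR: "embed (r *\<^sub>R a) = r *\<^sub>R embed a"
  by (simp_all add: unitization_eq_iff)

lemma embed_elem_part: "scalar_part u = 0 \<Longrightarrow> embed (elem_part u) = u"
  by (simp add: unitization_eq_iff)

lemma embed_inject: "embed a = embed b \<longleftrightarrow> a = b" by simp

lemma positive_embed_star_mult: "positive (embed (star a * a))"
  using positive_star_mult[of "embed a"] by (simp add: embed_mult embed_star)

text \<open>
  The distance of \<open>a\<close> from the cone of negative elements. It is bounded by the norm and nonpositive
  on that cone, so the linear functionals below it are contractive and positive; and on positive
  elements it equals the norm, because the norm is monotone there.
\<close>

definition cone_norm :: "'a::cstar_algebra \<Rightarrow> real" where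
  "cone_norm a = (INF k\<in>{k. positive (embed k)}. norm (a + k))"

lemma positive_embed_zero: "positive (embed (0::'a::cstar_algebra))"
  using positive_of_real[of 0, where 'a = "'a unitization"]
  by (simp add: zero_unitization_def)

lemma cone_norm_bdd: "bdd_below ((\<lambda>k. norm (a + k)) ` S)"
  by (rule bdd_belowI2[of _ 0]) simp

lemma cone_norm_le: "positive (embed k) \<Longrightarrow> cone_norm a \<le> norm (a + k)"
  unfolding cone_norm_def by (rule cINF_lower[OF cone_norm_bdd]) simp

lemma cone_norm_greatest:
  assumes "\<And>k. positive (embed k) \<Longrightarrow> c \<le> norm (a + k)"
  shows "c \<le> cone_norm a"
  unfolding cone_norm_def by (rule cINF_greatest) (use assms positive_embed_zero in auto)

lemma sublinear_cone_norm: "sublinear (cone_norm :: 'a::cstar_algebra \<Rightarrow> real)"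
  unfolding sublinear_def
proof safe
  fix x y :: 'a
  have "cone_norm (x + y) - norm (x + k) \<le> cone_norm y" if k: "positive (embed k)" for k
  proof (rule cone_norm_greatest)
    fix l :: 'a assume l: "positive (embed l)"
    have "cone_norm (x + y) \<le> norm ((x + y) + (k + l))"
      using positive_add[OF k l] by (intro cone_norm_le) (simp add: embed_add)
    also have "(x + y) + (k + l) = (x + k) + (y + l)" by simp
    also have "norm \<dots> \<le> norm (x + k) + norm (y + l)" by (rule norm_triangle_ineq)
    finally show "cone_norm (x + y) - norm (x + k) \<le> norm (y + l)" by simp
  qed
  then have "cone_norm (x + y) - cone_norm y \<le> cone_norm x"
    by (intro cone_norm_greatest) (simp add: algebra_simps)
  then show "cone_norm (x + y) \<le> cone_norm x + cone_norm y" by simp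
next
  fix r :: real and x :: 'a assume r: "r \<ge> 0"
  show "cone_norm (r *\<^sub>R x) \<le> r * cone_norm x"
  proof (cases "r = 0")
    case True
    then show ?thesis using cone_norm_le[OF positive_embed_zero, of 0] by simp
  next
    case False
    have "inverse r * cone_norm (r *\<^sub>R x) \<le> cone_norm x"
    proof (rule cone_norm_greatest)
      fix k :: 'a assume k: "positive (embed k)"
      have "cone_norm (r *\<^sub>R x) \<le> norm (r *\<^sub>R x + r *\<^sub>R k)"
        using positive_scaleR[OF k r] by (intro cone_norm_le) (simp add: embed_scaleR)
      also have "\<dots> = r * norm (x + k)" using r by (simp add: scaleR_add_right[symmetric])
      finally show "inverse r * cone_norm (r *\<^sub>R x) \<le> norm (x + k)"
        using r False by (simp add: field_simps)
    qed
    then show ?thesis using r False by (simp add: field_simps)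
  qed
qed

lemma cnj_sgn_mult: "cnj (sgn w) * w = of_real (cmod w)"
proof (cases "w = 0")
  case False
  have "w * cnj w = of_real (cmod w) * of_real (cmod w)"
    using complex_norm_square[of w] by (simp add: power2_eq_square)
  then show ?thesis using False by (simp add: sgn_eq field_simps)
qed simp

text \<open>
  A real linear functional below \<open>cone_norm\<close> that agrees with it at \<open>star d * d\<close> is complexified in
  the usual way.
\<close>

theorem norming_quasi_state:
  fixes d :: "'a::cstar_algebra"
  obtains \<phi> where "\<phi> \<in> quasi_state_space" "\<phi> (star d * d) = of_real ((norm d)\<^sup>2)"
proof -
  define c where "c = star d * d"
  have c: "star c = c" "norm c = (norm d)\<^sup>2" by (simp_all add: c_def star_mult star_star cstar_identity)
  obtain f where f: "linear f" "\<And>x. f x \<le> cone_norm x" "f c = cone_norm c"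
    using sublinear_dominates_linear[OF sublinear_cone_norm] by blast
  have cn_le: "cone_norm x \<le> norm x" for x :: 'a
    using cone_norm_le[OF positive_embed_zero, of x] by simp
  have "norm c \<le> cone_norm c"
  proof (rule cone_norm_greatest)
    fix k :: 'a assume "positive (embed k)"
    then have "norm (embed c) \<le> norm (embed c + embed k)"
      using positive_embed_star_mult[of d] unfolding c_def by (rule norm_mono_positive[rotated])
    then show "norm c \<le> norm (c + k)" by (simp add: embed_add[symmetric])
  qed
  then have fc: "f c = norm c" using f(3) cn_le[of c] by simp
  have f_pos: "f k \<ge> 0" if k: "positive (embed k)" for k
    using f(2)[of "- k"] cone_norm_le[OF k, of "- k"] linear_neg[OF f(1), of k] by simp
  \<comment> \<open>Without symmetrization \<open>f\<close> need not vanish on \<open>scaleC \<i> h\<close> for self-adjoint \<open>h\<close>, and the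
    complexification would not be real on self-adjoint elements.\<close>
  define g where "g a = (f a + f (star a)) / 2" for a
  have g_add: "g (x + y) = g x + g y" for x y
    by (simp add: g_def star_add linear_add[OF f(1)] add_divide_distrib)
  have g_scaleR: "g (r *\<^sub>R x) = r * g x" for r x
    by (simp add: g_def star_scaleR linear_scale[OF f(1)] algebra_simps)
  have f_le: "f x \<le> norm x" for x using f(2)[of x] cn_le[of x] by simp
  have g_le: "g x \<le> norm x" for x using f_le[of x] f_le[of "star x"] by (simp add: g_def)
  have g_imag: "g (scaleC \<i> h) = 0" if "star h = h" for h
    using that linear_neg[OF f(1), of "scaleC \<i> h"]
    by (simp add: g_def star_scaleC scaleC_minus_left)
  define \<phi> where "\<phi> a = Complex (g a) (- g (scaleC \<i> a))" for a
  have scaleC_split: "scaleC z a = Re z *\<^sub>R a + Im z *\<^sub>R scaleC \<i> a" for z and a :: 'a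
  proof -
    have "z = of_real (Re z) + of_real (Im z) * \<i>" by (simp add: complex_eq_iff)
    then have "scaleC z a = scaleC (of_real (Re z)) a + scaleC (of_real (Im z) * \<i>) a"
      by (metis scaleC_add_left)
    then show ?thesis by (simp add: scaleC_of_real scaleC_scaleC[symmetric])
  qed
  have \<phi>_add: "\<phi> (x + y) = \<phi> x + \<phi> y" for x y
    by (simp add: \<phi>_def scaleC_add_right g_add complex_eq_iff)
  have \<phi>_scaleC: "\<phi> (scaleC z a) = z * \<phi> a" for z a
  proof -
    have "g (scaleC z a) = Re z * g a + Im z * g (scaleC \<i> a)"
      unfolding scaleC_split[of z a] by (simp add: g_add g_scaleR)
    moreover have "g (scaleC \<i> (scaleC z a)) = Re z * g (scaleC \<i> a) - Im z * g a"
    proof -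
      have "scaleC \<i> (scaleC z a) = Re z *\<^sub>R scaleC \<i> a + (- Im z) *\<^sub>R a"
        using scaleC_split[of z "scaleC \<i> a"]
        by (simp add: scaleC_scaleC mult.commute scaleC_minus_left)
      then show ?thesis by (simp add: g_add g_scaleR del: scaleR_minus_left)
    qed
    ultimately show ?thesis by (simp add: \<phi>_def complex_eq_iff algebra_simps)
  qed
  have \<phi>_norm: "cmod (\<phi> a) \<le> norm a" for a
  proof -
    define z where "z = cnj (sgn (\<phi> a))"
    have z: "z * \<phi> a = of_real (cmod (\<phi> a))"
      unfolding z_def by (rule cnj_sgn_mult)
    have "cmod z \<le> 1" by (simp add: z_def norm_sgn)
    have "cmod (\<phi> a) = Re (\<phi> (scaleC z a))" by (simp add: \<phi>_scaleC z)
    also have "\<dots> = g (scaleC z a)" by (simp add: \<phi>_def)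
    also have "\<dots> \<le> cmod z * norm a" using g_le[of "scaleC z a"] by (simp add: norm_scaleC)
    also have "\<dots> \<le> norm a" using \<open>cmod z \<le> 1\<close> by (simp add: mult_left_le_one_le)
    finally show ?thesis .
  qed
  have \<phi>_sa: "\<phi> h = of_real (f h)" if "star h = h" for h
    using that by (simp add: \<phi>_def g_imag complex_eq_iff) (simp add: g_def)
  have "\<phi> (star a * a) \<in> \<real>\<^sub>\<ge>\<^sub>0" for a
    using \<phi>_sa[of "star a * a"] f_pos[OF positive_embed_star_mult, of a]
    by (simp add: star_mult star_star)
  then have "\<phi> \<in> quasi_state_space"
    unfolding quasi_state_space_iff using \<phi>_add \<phi>_scaleC \<phi>_norm by blast
  moreover have "\<phi> (star d * d) = of_real ((norm d)\<^sup>2)"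
    using \<phi>_sa[OF c(1)] fc c(2) by (simp add: c_def)
  ultimately show ?thesis using that by blast
qed

section \<open>The Cauchy-Schwarz inequality and its consequences\<close>

lemma nonneg_quadratic_discriminant:
  fixes a b c :: real
  assumes "\<And>t. 0 \<le> a + 2 * t * b + t\<^sup>2 * c"
  shows "b\<^sup>2 \<le> a * c"
proof (cases "c = 0")
  case True
  have "b = 0"
  proof (rule ccontr)
    assume "b \<noteq> 0"
    then show False using assms[of "- (a + 1) / (2 * b)"] True by (simp add: field_simps)
  qed
  then show ?thesis using True by simp
next
  case False
  have "c \<ge> 0"
  proof (rule ccontr)
    assume c: "\<not> c \<ge> 0"
    have *: "0 \<le> a + t\<^sup>2 * c" for t
      using assms[of t] assms[of "- t"] by simp
    have "a \<ge> 0" using *[of 0] by simp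
    then have "(sqrt ((a + 1) / - c))\<^sup>2 = (a + 1) / - c" using c by (intro real_sqrt_pow2) (simp add: divide_simps)
    then show False using *[of "sqrt ((a + 1) / - c)"] c by (simp add: divide_simps)
  qed
  then show ?thesis using assms[of "- b / c"] False by (simp add: field_simps power2_eq_square)
qed

lemma dual_space_add: "\<phi> \<in> dual_space \<Longrightarrow> \<phi> (x + y) = \<phi> x + \<phi> y"
  by (auto simp: dual_space_def intro: linear_add[OF bounded_linear.linear])

lemma dual_space_diff: "\<phi> \<in> dual_space \<Longrightarrow> \<phi> (x - y) = \<phi> x - \<phi> y"
  by (auto simp: dual_space_def intro: linear_diff[OF bounded_linear.linear])

lemma dual_space_scaleC: "\<phi> \<in> dual_space \<Longrightarrow> \<phi> (scaleC c x) = c * \<phi> x"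
  by (auto simp: dual_space_def)

lemma dual_space_scaleR: "\<phi> \<in> dual_space \<Longrightarrow> \<phi> (r *\<^sub>R x) = of_real r * \<phi> x"
  using dual_space_scaleC[of \<phi> "of_real r" x] by (simp add: scaleC_of_real)

lemma positive_functional_expand:
  assumes "\<phi> \<in> dual_space"
  shows "\<phi> (star (x + scaleC c y) * (x + scaleC c y)) =
    \<phi> (star x * x) + c * \<phi> (star x * y) + cnj c * \<phi> (star y * x) + of_real ((cmod c)\<^sup>2) * \<phi> (star y * y)"
  using assms unfolding complex_norm_square
  by (simp add: star_add star_scaleC distrib_left distrib_right mult_scaleC_left mult_scaleC_right
      scaleC_scaleC dual_space_add dual_space_scaleC mult.assoc)

text \<open>
  Positivity makes \<open>\<phi> (star x * y)\<close> a Hermitian form. Rotating \<open>y\<close> by the phase \<open>u\<close> turns the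
  expansion of \<open>\<phi>\<close> at \<open>star (x + t * u * y) * (x + t * u * y)\<close> into a real quadratic polynomial
  in \<open>t\<close> with middle coefficient \<open>2 * cmod (\<phi> (star x * y))\<close>.
\<close>

theorem positive_functional_Cauchy_Schwarz:
  assumes \<phi>: "\<phi> \<in> dual_space" and pos: "\<And>a. \<phi> (star a * a) \<in> \<real>\<^sub>\<ge>\<^sub>0"
  shows "(cmod (\<phi> (star x * y)))\<^sup>2 \<le> Re (\<phi> (star x * x)) * Re (\<phi> (star y * y))"
proof -
  let ?s = "\<phi> (star x * y)" and ?r = "\<phi> (star y * x)"
  have real: "Im (\<phi> (star a * a)) = 0" and nonneg: "0 \<le> Re (\<phi> (star a * a))" for a
    using pos[of a] by (auto simp: complex_nonneg_Reals_iff)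
  have "?r = cnj ?s"
    using real[of "x + scaleC 1 y"] real[of "x + scaleC \<i> y"]
    unfolding positive_functional_expand[OF \<phi>] by (simp add: real complex_eq_iff)
  moreover define u where "u = cnj (sgn ?s)"
  have us: "u * ?s = of_real (cmod ?s)"
    unfolding u_def by (rule cnj_sgn_mult)
  have "0 \<le> Re (\<phi> (star x * x)) + 2 * t * cmod ?s + t\<^sup>2 * Re (\<phi> (star y * y))" for t
  proof -
    have c: "Re (of_real t * u * ?s) = t * cmod ?s" using us by (simp only: mult.assoc) simp
    have "Re (cnj (of_real t * u) * cnj ?s) = Re (cnj (of_real t * u * ?s))" by simp
    then have c': "Re (cnj (of_real t * u) * cnj ?s) = t * cmod ?s" using c by simp
    have "(cmod (of_real t * u))\<^sup>2 \<le> t\<^sup>2"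
      by (simp add: u_def norm_mult norm_sgn)
    then have "(cmod (of_real t * u))\<^sup>2 * Re (\<phi> (star y * y)) \<le> t\<^sup>2 * Re (\<phi> (star y * y))"
      by (intro mult_right_mono nonneg)
    moreover have "0 \<le> Re (\<phi> (star x * x)) + Re (of_real t * u * ?s) + Re (cnj (of_real t * u) * cnj ?s)
        + (cmod (of_real t * u))\<^sup>2 * Re (\<phi> (star y * y))"
      using nonneg[of "x + scaleC (of_real t * u) y"] \<open>?r = cnj ?s\<close>
      unfolding positive_functional_expand[OF \<phi>] by (simp only: plus_complex.sel Re_complex_of_real Im_complex_of_real times_complex.sel(1))
    ultimately show ?thesis unfolding c c' by linarith
  qed
  then show ?thesis by (rule nonneg_quadratic_discriminant)
qed

lemma positive_functional_triangle:
  assumes \<phi>: "\<phi> \<in> dual_space" and pos: "\<And>a. \<phi> (star a * a) \<in> \<real>\<^sub>\<ge>\<^sub>0"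
  shows "sqrt (Re (\<phi> (star (x + y) * (x + y))))
    \<le> sqrt (Re (\<phi> (star x * x))) + sqrt (Re (\<phi> (star y * y)))"
proof -
  have nonneg: "0 \<le> Re (\<phi> (star a * a))" for a
    using pos[of a] by (auto simp: complex_nonneg_Reals_iff)
  let ?a = "Re (\<phi> (star x * x))" and ?b = "Re (\<phi> (star y * y))"
  have cs: "Re (\<phi> (star u * v)) \<le> sqrt (Re (\<phi> (star u * u))) * sqrt (Re (\<phi> (star v * v)))" for u v
  proof -
    have "cmod (\<phi> (star u * v)) \<le> sqrt (Re (\<phi> (star u * u)) * Re (\<phi> (star v * v)))"
      by (rule real_le_rsqrt[OF positive_functional_Cauchy_Schwarz[OF assms]])
    then show ?thesis
      using complex_Re_le_cmod[of "\<phi> (star u * v)"] by (simp add: real_sqrt_mult)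
  qed
  have "Re (\<phi> (star (x + y) * (x + y))) = ?a + Re (\<phi> (star x * y)) + Re (\<phi> (star y * x)) + ?b"
    by (simp add: star_add distrib_left distrib_right dual_space_add[OF \<phi>])
  also have "\<dots> \<le> ?a + sqrt ?a * sqrt ?b + sqrt ?b * sqrt ?a + ?b"
    by (intro add_mono cs order_refl)
  also have "\<dots> = (sqrt ?a + sqrt ?b)\<^sup>2"
    using nonneg by (simp add: power2_eq_square algebra_simps)
  finally show ?thesis
    by (intro real_le_lsqrt) (simp_all add: nonneg)
qed

text \<open>
  If \<open>k\<close> is the root of \<open>(norm a)\<^sup>2 - star a * a\<close> in the unitization, then \<open>y = k * b\<close> lies in the
  ideal \<open>'a\<close>, and \<open>star y * y\<close> is the difference of the two arguments of \<open>\<phi>\<close>.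
\<close>

lemma positive_functional_mult_le:
  assumes \<phi>: "\<phi> \<in> dual_space" and pos: "\<And>a. \<phi> (star a * a) \<in> \<real>\<^sub>\<ge>\<^sub>0"
  shows "Re (\<phi> (star (a * b) * (a * b))) \<le> (norm a)\<^sup>2 * Re (\<phi> (star b * b))"
proof -
  let ?g = "embed (star a * a)"
  have g: "star ?g = ?g" by (simp add: embed_star[symmetric] star_mult star_star)
  have "norm ?g = (norm a)\<^sup>2" by (simp add: cstar_identity)
  with positive_norm_diff[OF g] have "positive (of_real ((norm a)\<^sup>2) - ?g)" by (simp del: of_real_power)
  from positive_sqrt[OF this] obtain k where k: "positive k" "k * k = of_real ((norm a)\<^sup>2) - ?g"
    by blast
  define y where "y = elem_part (k * embed b)"
  have y: "embed y = k * embed b" unfolding y_def by (rule embed_elem_part) simp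
  have "embed (star y * y) = star (embed b) * (k * k) * embed b"
    using k(1) by (simp add: embed_mult embed_star y star_mult positive_self_adjoint mult.assoc)
  also have "\<dots> = embed ((norm a)\<^sup>2 *\<^sub>R (star b * b) - star (a * b) * (a * b))"
    unfolding k(2)
    by (simp add: left_diff_distrib right_diff_distrib mult_of_real del: of_real_power)
       (simp add: unitization_eq_iff star_mult mult.assoc)
  finally have "star y * y = (norm a)\<^sup>2 *\<^sub>R (star b * b) - star (a * b) * (a * b)"
    by (simp only: embed_inject)
  then have "0 \<le> Re (\<phi> ((norm a)\<^sup>2 *\<^sub>R (star b * b) - star (a * b) * (a * b)))"
    using pos[of y] by (simp add: complex_nonneg_Reals_iff)
  then show ?thesis
    by (simp add: dual_space_diff[OF \<phi>] dual_space_scaleR[OF \<phi>])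
qed

section \<open>Approximate left units\<close>

text \<open>
  For numbers \<open>0 \<le> c \<le> 1\<close> and \<open>v = 1 - c\<close> the identity \<open>1 - v ^ n = (\<Sum>j<n. c * v ^ j)\<close>, with
  decreasing terms, gives \<open>n * c * v ^ n \<le> 1 - v ^ n \<le> 1\<close>. The same induction works in the order
  of the algebra, and monotonicity of the norm turns it into the third bound.
\<close>

lemma norm_mult_power_one_minus_le:
  fixes c :: "'a::{cstar_algebra,real_normed_algebra_1}"
  assumes c: "positive c" "norm c \<le> 1"
  shows "norm ((1 - c) ^ n) \<le> 1" "norm (1 - (1 - c) ^ n) \<le> 1" "real n * norm (c * (1 - c) ^ n) \<le> 1"
proof -
  define v where "v = 1 - c"
  have v: "positive v" unfolding v_def
    using positive_of_real_diff[of c 1] c positive_self_adjoint[OF c(1)] by simp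
  have "norm v \<le> 1" using norm_le_of_positive_diff[OF v, of 1] c by (simp add: v_def)
  then have vn: "norm (v ^ m) \<le> 1" for m
    by (meson norm_ge_zero norm_power_ineq order_trans power_le_one)
  have pvn: "positive (1 - v ^ m)" for m
    using positive_of_real_diff[of "v ^ m" 1] positive_self_adjoint[OF positive_power[OF v]] vn by simp
  have nvn: "norm (1 - v ^ m) \<le> 1" for m
    using norm_le_of_positive_diff[OF pvn, of 1 m] positive_power[OF v] by simp
  have cv: "c * v = v * c" by (simp add: v_def algebra_simps)
  have cvn: "c * v ^ m = v ^ m * c" for m using power_commuting_commutes[of v c m] cv by simp
  have pc: "positive (c * v ^ m)" for m by (intro positive_mult c positive_power v cvn)
  have "positive (1 - v ^ m - real m *\<^sub>R (c * v ^ m))" for m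
  proof (induction m)
    case 0 then show ?case using positive_of_real[of 0] by simp
  next
    case (Suc m)
    let ?G = "1 - v ^ m - real m *\<^sub>R (c * v ^ m)"
    have vc: "v * (c * v ^ k) = c * v ^ Suc k" for k by (simp add: mult.assoc[symmetric] cv)
    have "v * ?G = ?G * v"
      by (simp add: left_diff_distrib right_diff_distrib power_commutes mult.assoc vc)
    then have "positive (v * ?G)" by (intro positive_mult v Suc)
    moreover have "positive (c * (1 - v ^ Suc m))"
      by (intro positive_mult c pvn) (simp only: left_diff_distrib right_diff_distrib cvn mult_1_left mult_1_right)
    ultimately have "positive (v * ?G + c * (1 - v ^ Suc m))" by (rule positive_add)
    also have "v * ?G + c * (1 - v ^ Suc m) = 1 - v ^ Suc m - real (Suc m) *\<^sub>R (c * v ^ Suc m)"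
    proof -
      have "v * ?G = v - v ^ Suc m - real m *\<^sub>R (c * v ^ Suc m)"
        unfolding vc[symmetric] by (simp add: right_diff_distrib)
      moreover have "c * (1 - v ^ Suc m) = c - c * v ^ Suc m"
        by (simp only: right_diff_distrib mult_1_right)
      moreover have "real (Suc m) *\<^sub>R (c * v ^ Suc m) = real m *\<^sub>R (c * v ^ Suc m) + c * v ^ Suc m"
        by (simp only: of_nat_Suc scaleR_add_left scaleR_one add.commute)
      moreover have "v + c = 1" by (simp add: v_def)
      ultimately show ?thesis by (simp add: algebra_simps)
    qed
    finally show ?case .
  qed
  then have "norm (real n *\<^sub>R (c * v ^ n)) \<le> norm (1 - v ^ n)"
    using norm_mono_positive[OF positive_scaleR[OF pc, of "real n" n], of "1 - v ^ n - real n *\<^sub>R (c * v ^ n)"] by simp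
  then have "real n * norm (c * v ^ n) \<le> 1" using nvn[of n] by simp
  then show "norm ((1 - c) ^ n) \<le> 1" "norm (1 - (1 - c) ^ n) \<le> 1" "real n * norm (c * (1 - c) ^ n) \<le> 1"
    using vn nvn by (simp_all add: v_def)
qed

text \<open>
  Let \<open>c\<close> be \<open>b * star b\<close> scaled to norm 1. Then \<open>e = 1 - (1 - c) ^ n\<close> has no scalar part, so it lies
  in \<open>'a\<close>, and \<open>b - e * b = (1 - c) ^ n * b\<close>, whose norm is governed by \<open>c * (1 - c) ^ n\<close>.
\<close>

lemma approximate_left_unit:
  fixes b :: "'a::cstar_algebra"
  assumes "\<epsilon> > 0"
  obtains e where "norm e \<le> 1" "norm (e * b - b) \<le> \<epsilon>"
proof (cases "b = 0")
  case True then show ?thesis using that[of 0] assms by simp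
next
  case False
  define c where "c = (1 / (norm b)\<^sup>2) *\<^sub>R embed (b * star b)"
  have "positive (embed (b * star b))" using positive_embed_star_mult[of "star b"] by (simp add: star_star)
  then have pc: "positive c" unfolding c_def by (intro positive_scaleR) auto
  have nc: "norm c \<le> 1" using False by (simp add: c_def norm_mult_star)
  have bb: "embed b * star (embed b) = (norm b)\<^sup>2 *\<^sub>R c"
    using False by (simp add: c_def embed_mult embed_star)
  define v where "v = 1 - c"
  have sv: "star v = v" using positive_self_adjoint[OF pc] by (simp add: v_def star_diff)
  obtain n :: nat where n: "(norm b)\<^sup>2 / \<epsilon>\<^sup>2 < real n" using reals_Archimedean2 by blast
  have "0 \<le> (norm b)\<^sup>2 / \<epsilon>\<^sup>2" by simp
  with n have n0: "real n > 0" by linarith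
  define e where "e = elem_part (1 - v ^ n)"
  have sc: "scalar_part (v ^ m) = 1" for m
    by (induction m) (simp_all add: v_def c_def)
  have e: "embed e = 1 - v ^ n" unfolding e_def by (rule embed_elem_part) (simp add: sc)
  have "norm e \<le> 1"
    using norm_mult_power_one_minus_le(2)[OF pc nc, of n] e by (metis norm_Unitization_0 v_def)
  moreover have "norm (e * b - b) \<le> \<epsilon>"
  proof -
    have "embed (b - e * b) = v ^ n * embed b"
    proof -
      have "embed (b - e * b) = embed b - embed e * embed b" by (simp add: unitization_eq_iff)
      then show ?thesis unfolding e by (simp add: left_diff_distrib)
    qed
    then have "norm (e * b - b) = norm (v ^ n * embed b)"
      by (metis norm_Unitization_0 norm_minus_commute)
    then have "(norm (e * b - b))\<^sup>2 = norm ((v ^ n * embed b) * star (v ^ n * embed b))"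
      by (simp only: norm_mult_star)
    also have "(v ^ n * embed b) * star (v ^ n * embed b) = v ^ n * (embed b * star (embed b)) * v ^ n"
      by (simp only: star_mult star_power sv mult.assoc)
    also have "\<dots> = (norm b)\<^sup>2 *\<^sub>R (c * v ^ n * v ^ n)"
    proof -
      have "c * v ^ n = v ^ n * c"
        using power_commuting_commutes[of v c n] by (simp add: v_def algebra_simps)
      then show ?thesis unfolding bb by (simp add: mult.assoc)
    qed
    also have "norm \<dots> \<le> (norm b)\<^sup>2 * norm (c * v ^ n)"
    proof -
      have "norm (c * v ^ n * v ^ n) \<le> norm (c * v ^ n) * norm (v ^ n)" by (rule norm_mult_ineq)
      also have "\<dots> \<le> norm (c * v ^ n)"
        using norm_mult_power_one_minus_le(1)[OF pc nc, of n] by (simp add: v_def mult_left_le)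
      finally show ?thesis by (simp add: mult_left_mono)
    qed
    also have "\<dots> \<le> (norm b)\<^sup>2 * (1 / real n)"
      using norm_mult_power_one_minus_le(3)[OF pc nc, of n] n0
      by (intro mult_left_mono) (simp_all add: v_def field_simps)
    also have "\<dots> \<le> \<epsilon>\<^sup>2" using n n0 assms by (simp add: field_simps)
    finally show ?thesis by (rule power2_le_imp_le) (use assms in simp)
  qed
  ultimately show ?thesis using that by blast
qed

section \<open>Weak* compact sets of states\<close>

lemma state_space_dual: "\<phi> \<in> state_space \<Longrightarrow> \<phi> \<in> dual_space"
  and state_space_pos: "\<phi> \<in> state_space \<Longrightarrow> \<phi> (star a * a) \<in> \<real>\<^sub>\<ge>\<^sub>0"
  by (simp_all add: state_space_def)

lemma state_space_norm_le: "\<phi> \<in> state_space \<Longrightarrow> cmod (\<phi> a) \<le> norm a"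
  using onorm[of \<phi> a] by (simp add: state_space_def dual_space_def)

lemma quasi_state_space_dual: "\<phi> \<in> quasi_state_space \<Longrightarrow> \<phi> \<in> dual_space"
  and quasi_state_space_pos: "\<phi> \<in> quasi_state_space \<Longrightarrow> \<phi> (star a * a) \<in> \<real>\<^sub>\<ge>\<^sub>0"
  and quasi_state_space_norm_le: "\<phi> \<in> quasi_state_space \<Longrightarrow> cmod (\<phi> a) \<le> norm a"
  by (simp_all add: quasi_state_space_def)

lemma compactin_weak_star_iff:
  "compactin weak_star_topology K \<longleftrightarrow> compact K \<and> K \<subseteq> dual_space"
  by (simp add: weak_star_topology_def compactin_subtopology euclidean_product_topology)

text \<open>
  The Banach-Alaoglu argument: the set is closed in a product of discs, which is compact by
  Tychonoff's theorem.
\<close>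

lemma compact_quasi_state_space_ge:
  "compact {\<phi> \<in> quasi_state_space. \<epsilon> \<le> Re (\<phi> (c::'a::cstar_algebra))}"
proof -
  let ?P = "PiE UNIV (\<lambda>a::'a. cball (0::complex) (norm a))"
  have "compactin (product_topology (\<lambda>_. euclidean) UNIV) ?P"
    by (simp add: compactin_PiE)
  then have P: "compact ?P" by (simp add: euclidean_product_topology)
  have coord: "continuous_on UNIV (\<lambda>\<phi>::'a \<Rightarrow> complex. \<phi> a)" for a
    by (rule continuous_on_product_coordinates)
  have "closed {\<phi>::'a \<Rightarrow> complex. \<forall>x y. \<phi> (x + y) = \<phi> x + \<phi> y}"
    by (intro closed_Collect_all closed_Collect_eq continuous_intros coord)
  moreover have "closed {\<phi>::'a \<Rightarrow> complex. \<forall>z a. \<phi> (scaleC z a) = z * \<phi> a}"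
    by (intro closed_Collect_all closed_Collect_eq continuous_intros coord)
  moreover have "closed {\<phi>::'a \<Rightarrow> complex. \<forall>a. \<phi> (star a * a) \<in> \<real>\<^sub>\<ge>\<^sub>0}"
  proof (intro closed_Collect_all)
    fix a :: 'a
    have "closed ((\<lambda>\<phi>::'a \<Rightarrow> complex. \<phi> (star a * a)) -` \<real>\<^sub>\<ge>\<^sub>0)"
      by (rule closed_vimage[OF closed_nonneg_Reals_complex coord])
    then show "closed {\<phi>::'a \<Rightarrow> complex. \<phi> (star a * a) \<in> \<real>\<^sub>\<ge>\<^sub>0}" by (simp add: vimage_def)
  qed
  moreover have "closed {\<phi>::'a \<Rightarrow> complex. \<epsilon> \<le> Re (\<phi> c)}"
    by (intro closed_Collect_le continuous_intros coord)
  ultimately have "compact (?P \<inter> ({\<phi>. \<forall>x y. \<phi> (x + y) = \<phi> x + \<phi> y} \<inter>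
     ({\<phi>. \<forall>z a. \<phi> (scaleC z a) = z * \<phi> a} \<inter> ({\<phi>. \<forall>a. \<phi> (star a * a) \<in> \<real>\<^sub>\<ge>\<^sub>0} \<inter> {\<phi>. \<epsilon> \<le> Re (\<phi> c)}))))"
    by (intro compact_Int_closed P closed_Int)
  also have "\<dots> = {\<phi> \<in> quasi_state_space. \<epsilon> \<le> Re (\<phi> c)}"
    by (auto simp: quasi_state_space_iff PiE_iff)
  finally show ?thesis .
qed

definition compress :: "'a::cstar_algebra \<Rightarrow> ('a \<Rightarrow> complex) \<Rightarrow> 'a \<Rightarrow> complex" where
  "compress b \<phi> a = \<phi> (star b * a * b) / \<phi> (star b * b)"

text \<open>
  That the norm is at most 1 is the Cauchy-Schwarz inequality for \<open>\<phi> (star b * (a * b))\<close>. It is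
  attained in the limit along approximate left units for \<open>b\<close>, at which \<open>\<phi> (star b * e * b)\<close>
  approaches \<open>\<phi> (star b * b)\<close>.
\<close>

lemma compress_state:
  assumes \<phi>: "\<phi> \<in> quasi_state_space" and b: "0 < Re (\<phi> (star b * b))"
  shows "compress b \<phi> \<in> state_space"
proof -
  note dual = quasi_state_space_dual[OF \<phi>] and pos = quasi_state_space_pos[OF \<phi>]
  define r where "r = Re (\<phi> (star b * b))"
  have r: "\<phi> (star b * b) = of_real r" "r > 0"
    using pos[of b] b by (auto simp: r_def complex_nonneg_Reals_iff complex_eq_iff)
  have le: "cmod (compress b \<phi> a) \<le> norm a" for a
  proof -
    have "(cmod (\<phi> (star b * (a * b))))\<^sup>2 \<le> r * Re (\<phi> (star (a * b) * (a * b)))"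
      using positive_functional_Cauchy_Schwarz[OF dual pos, of b "a * b"] r by simp
    also have "\<dots> \<le> r * ((norm a)\<^sup>2 * r)"
      using positive_functional_mult_le[OF dual pos, of a b] r by (intro mult_left_mono) auto
    also have "\<dots> = (norm a * r)\<^sup>2" by (simp add: power2_eq_square)
    finally have "cmod (\<phi> (star b * (a * b))) \<le> norm a * r"
      by (rule power2_le_imp_le) (use r in simp)
    then show ?thesis using r by (simp add: compress_def norm_divide divide_simps mult.assoc)
  qed
  have add: "compress b \<phi> (x + y) = compress b \<phi> x + compress b \<phi> y" for x y
    by (simp add: compress_def distrib_left distrib_right dual_space_add[OF dual] add_divide_distrib)
  have scaleC: "compress b \<phi> (scaleC z x) = z * compress b \<phi> x" for z x
    by (simp add: compress_def mult_scaleC_left mult_scaleC_right dual_space_scaleC[OF dual])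
  have pos': "compress b \<phi> (star x * x) \<in> \<real>\<^sub>\<ge>\<^sub>0" for x
  proof -
    have "compress b \<phi> (star x * x) = \<phi> (star (x * b) * (x * b)) / of_real r"
      by (simp add: compress_def r star_mult mult.assoc)
    then show ?thesis using pos[of "x * b"] r by (simp add: complex_nonneg_Reals_iff)
  qed
  have "compress b \<phi> \<in> quasi_state_space"
    unfolding quasi_state_space_iff using add scaleC pos' le by blast
  then have dual': "compress b \<phi> \<in> dual_space" by (rule quasi_state_space_dual)
  then have bl: "bounded_linear (compress b \<phi>)" by (simp add: dual_space_def)
  have "onorm (compress b \<phi>) = 1"
  proof (rule antisym)
    show "onorm (compress b \<phi>) \<le> 1" by (rule onorm_bound) (use le in auto)
    show "1 \<le> onorm (compress b \<phi>)"
    proof (rule field_le_epsilon)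
      fix \<epsilon> :: real assume \<epsilon>: "\<epsilon> > 0"
      have "\<epsilon> * r / (norm b + 1) > 0" using \<epsilon> r by (simp add: add_nonneg_pos)
      then obtain e where e: "norm e \<le> 1" "norm (e * b - b) \<le> \<epsilon> * r / (norm b + 1)"
        using approximate_left_unit by blast
      have "cmod (\<phi> (star b * e * b) - \<phi> (star b * b)) \<le> norm (star b * (e * b - b))"
        unfolding dual_space_diff[OF dual, symmetric]
        by (simp add: right_diff_distrib mult.assoc quasi_state_space_norm_le[OF \<phi>])
      also have "\<dots> \<le> norm b * norm (e * b - b)"
        using norm_mult_ineq[of "star b" "e * b - b"] by simp
      also have "\<dots> \<le> norm b * (\<epsilon> * r / (norm b + 1))" using e(2) by (intro mult_left_mono) auto
      also have "\<dots> = (norm b / (norm b + 1)) * (\<epsilon> * r)" by simp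
      also have "\<dots> \<le> 1 * (\<epsilon> * r)"
        using \<epsilon> r by (intro mult_right_mono) (simp_all add: divide_le_eq_1 add_nonneg_pos)
      finally have "cmod (\<phi> (star b * e * b) - of_real r) \<le> \<epsilon> * r" using r by simp
      moreover have "cmod (of_real r) \<le> cmod (\<phi> (star b * e * b)) + cmod (\<phi> (star b * e * b) - of_real r)"
        using norm_triangle_ineq4[of "\<phi> (star b * e * b)" "\<phi> (star b * e * b) - of_real r"] by simp
      ultimately have "r \<le> cmod (\<phi> (star b * e * b)) + \<epsilon> * r" using r by simp
      also have "cmod (\<phi> (star b * e * b)) = cmod (compress b \<phi> e) * r"
        using r by (simp add: compress_def norm_divide)
      also have "cmod (compress b \<phi> e) \<le> onorm (compress b \<phi>)"
      proof -
        have "cmod (compress b \<phi> e) \<le> onorm (compress b \<phi>) * norm e" by (rule onorm[OF bl])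
        also have "\<dots> \<le> onorm (compress b \<phi>)" using e(1) onorm_pos_le[OF bl] by (simp add: mult_left_le)
        finally show ?thesis .
      qed
      finally have "1 * r \<le> (onorm (compress b \<phi>) + \<epsilon>) * r" using r by (simp add: algebra_simps)
      then show "1 \<le> onorm (compress b \<phi>) + \<epsilon>" using r(2) by (rule mult_right_le_imp_le)
    qed
  qed
  then show ?thesis using dual' pos' by (simp add: state_space_def)
qed

lemma compact_compress_image:
  assumes "\<epsilon> > 0"
  shows "compact (compress b ` {\<phi> \<in> quasi_state_space. \<epsilon> \<le> Re (\<phi> (star b * b))})"
proof (rule compact_continuous_image[OF _ compact_quasi_state_space_ge])
  show "continuous_on {\<phi> \<in> quasi_state_space. \<epsilon> \<le> Re (\<phi> (star b * b))} (compress b)"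
    unfolding compress_def[abs_def]
  proof (intro continuous_on_coordinatewise_then_product continuous_on_divide)
    show "continuous_on S (\<lambda>\<phi>. \<phi> a)" for S and a :: 'a
      by (rule continuous_on_subset[OF continuous_on_product_coordinates]) simp
    then show "continuous_on S (\<lambda>\<phi>. \<phi> a)" for S and a :: 'a .
    show "\<forall>\<phi>\<in>{\<phi> \<in> quasi_state_space. \<epsilon> \<le> Re (\<phi> (star b * b))}. \<phi> (star b * b) \<noteq> 0"
      using assms by auto
  qed
qed

section \<open>The seminorms\<close>

lemma su_seminorm_bdd:
  assumes "K \<subseteq> state_space"
  shows "bdd_above ((\<lambda>\<phi>. max (sqrt (Re (\<phi> (star a * a)))) (sqrt (Re (\<phi> (a * star a))))) ` K)"
proof (rule bdd_aboveI2)
  fix \<phi> assume "\<phi> \<in> K"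
  then have \<phi>: "\<phi> \<in> state_space" using assms by blast
  have "Re (\<phi> (star a * a)) \<le> (norm a)\<^sup>2" "Re (\<phi> (a * star a)) \<le> (norm a)\<^sup>2"
    using state_space_norm_le[OF \<phi>, of "star a * a"] state_space_norm_le[OF \<phi>, of "a * star a"]
      complex_Re_le_cmod[of "\<phi> (star a * a)"] complex_Re_le_cmod[of "\<phi> (a * star a)"]
    by (auto simp: cstar_identity norm_mult_star)
  then show "max (sqrt (Re (\<phi> (star a * a)))) (sqrt (Re (\<phi> (a * star a)))) \<le> norm a"
    by (auto intro: real_le_lsqrt)
qed

lemma su_seminorm_upper:
  assumes "K \<subseteq> state_space" "\<phi> \<in> K"
  shows "sqrt (Re (\<phi> (star a * a))) \<le> su_seminorm K a"
    "sqrt (Re (\<phi> (a * star a))) \<le> su_seminorm K a"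
  using cSUP_upper[OF assms(2) su_seminorm_bdd[OF assms(1)], of a] assms(2)
  by (auto simp: su_seminorm_def)

lemma su_seminorm_least:
  assumes "0 \<le> c" "\<And>\<phi>. \<phi> \<in> K \<Longrightarrow> sqrt (Re (\<phi> (star a * a))) \<le> c"
    "\<And>\<phi>. \<phi> \<in> K \<Longrightarrow> sqrt (Re (\<phi> (a * star a))) \<le> c"
  shows "su_seminorm K a \<le> c"
  unfolding su_seminorm_def using assms by (auto intro!: cSUP_least)

lemma su_seminorm_nonneg:
  assumes "K \<subseteq> state_space"
  shows "0 \<le> su_seminorm K a"
proof (cases "K = {}")
  case True then show ?thesis by (simp add: su_seminorm_def)
next
  case False
  then obtain \<phi> where \<phi>: "\<phi> \<in> K" by blast
  then have "0 \<le> Re (\<phi> (star a * a))"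
    using state_space_pos[of \<phi> a] assms by (auto simp: complex_nonneg_Reals_iff)
  then have "0 \<le> sqrt (Re (\<phi> (star a * a)))" by simp
  then show ?thesis using su_seminorm_upper(1)[OF assms \<phi>, of a] by linarith
qed

lemma su_seminorm_zero: "K \<subseteq> state_space \<Longrightarrow> su_seminorm K 0 = 0"
proof (rule antisym)
  assume K: "K \<subseteq> state_space"
  show "0 \<le> su_seminorm K 0" by (rule su_seminorm_nonneg[OF K])
  have "Re (\<phi> 0) \<le> 0" if "\<phi> \<in> K" for \<phi>
    using state_space_norm_le[of \<phi> 0] K that by auto
  then show "su_seminorm K 0 \<le> 0" by (intro su_seminorm_least) auto
qed

lemma su_seminorm_star: "su_seminorm K (star a) = su_seminorm K a"
  by (simp add: su_seminorm_def star_star max.commute)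

lemma su_seminorm_triangle:
  assumes K: "K \<subseteq> state_space"
  shows "su_seminorm K (x + y) \<le> su_seminorm K x + su_seminorm K y"
proof (rule su_seminorm_least)
  show "0 \<le> su_seminorm K x + su_seminorm K y" using su_seminorm_nonneg[OF K] by simp
  fix \<phi> assume \<phi>K: "\<phi> \<in> K"
  then have \<phi>: "\<phi> \<in> state_space" using K by blast
  note tri = positive_functional_triangle[OF state_space_dual[OF \<phi>] state_space_pos[OF \<phi>]]
  show "sqrt (Re (\<phi> (star (x + y) * (x + y)))) \<le> su_seminorm K x + su_seminorm K y"
    using tri[of x y] su_seminorm_upper(1)[OF K \<phi>K] by (meson add_mono order_trans)
  show "sqrt (Re (\<phi> ((x + y) * star (x + y)))) \<le> su_seminorm K x + su_seminorm K y"
    using tri[of "star x" "star y"] su_seminorm_upper(2)[OF K \<phi>K]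
    by (simp add: star_star star_add) (meson add_mono order_trans)
qed

section \<open>Comparison on bounded sets\<close>

text \<open>
  For a positive functional \<open>\<phi>\<close> norming \<open>star (a * b) * (a * b)\<close>, the first term of the maximum
  is the bound in case \<open>\<phi> (star b * b) \<ge> \<epsilon>\<close>, when \<open>compress b \<phi>\<close> belongs to the compact set \<open>K\<close>.
  The second is the bound in the remaining case, when \<open>\<phi> (star b * b)\<close> is too small to be divided
  by.
\<close>

lemma norm_mult_right_le_su_seminorm:
  fixes b :: "'a::cstar_algebra"
  assumes \<epsilon>: "\<epsilon> > 0"
  obtains K where "K \<subseteq> state_space" "compactin weak_star_topology K"
    "\<And>a. (norm (a * b))\<^sup>2 \<le> max ((norm b)\<^sup>2 * (su_seminorm K a)\<^sup>2) ((norm a)\<^sup>2 * \<epsilon>)"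
proof -
  define K where "K = compress b ` {\<phi> \<in> quasi_state_space. \<epsilon> \<le> Re (\<phi> (star b * b))}"
  have K: "K \<subseteq> state_space"
    unfolding K_def using \<epsilon> by (auto intro!: compress_state)
  then have "compactin weak_star_topology K"
    unfolding compactin_weak_star_iff
    using compact_compress_image[OF \<epsilon>, of b] state_space_dual by (auto simp: K_def)
  moreover have "(norm (a * b))\<^sup>2 \<le> max ((norm b)\<^sup>2 * (su_seminorm K a)\<^sup>2) ((norm a)\<^sup>2 * \<epsilon>)" for a
  proof -
    obtain \<phi> where \<phi>: "\<phi> \<in> quasi_state_space" "\<phi> (star (a * b) * (a * b)) = of_real ((norm (a * b))\<^sup>2)"
      using norming_quasi_state by blast
    define r where "r = Re (\<phi> (star b * b))"
    have r: "\<phi> (star b * b) = of_real r" "r \<ge> 0"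
      using quasi_state_space_pos[OF \<phi>(1), of b] by (auto simp: r_def complex_nonneg_Reals_iff complex_eq_iff)
    show ?thesis
    proof (cases "\<epsilon> \<le> r")
      case True
      then have \<psi>: "compress b \<phi> \<in> K" using \<phi>(1) by (auto simp: K_def r_def)
      have "compress b \<phi> (star a * a) = of_real ((norm (a * b))\<^sup>2) / of_real r"
        using \<phi>(2) r by (simp add: compress_def star_mult mult.assoc)
      then have "Re (compress b \<phi> (star a * a)) = (norm (a * b))\<^sup>2 / r"
        by (simp add: Re_divide_of_real del: of_real_power)
      then have "sqrt ((norm (a * b))\<^sup>2 / r) \<le> su_seminorm K a"
        using su_seminorm_upper(1)[OF K \<psi>, of a] by simp
      then have "(norm (a * b))\<^sup>2 / r \<le> (su_seminorm K a)\<^sup>2"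
        by (rule sqrt_le_D)
      then have "(norm (a * b))\<^sup>2 \<le> r * (su_seminorm K a)\<^sup>2"
        using True \<epsilon> by (simp add: field_simps)
      also have "r \<le> (norm b)\<^sup>2"
        using quasi_state_space_norm_le[OF \<phi>(1), of "star b * b"] r by (simp add: cstar_identity)
      then have "r * (su_seminorm K a)\<^sup>2 \<le> (norm b)\<^sup>2 * (su_seminorm K a)\<^sup>2"
        by (rule mult_right_mono) simp
      finally show ?thesis by simp
    next
      case False
      have "(norm (a * b))\<^sup>2 \<le> (norm a)\<^sup>2 * r"
        using positive_functional_mult_le[OF quasi_state_space_dual[OF \<phi>(1)]
            quasi_state_space_pos[OF \<phi>(1)], of a b] \<phi>(2) r by (simp del: of_real_power)
      also have "\<dots> \<le> (norm a)\<^sup>2 * \<epsilon>" using False by (intro mult_left_mono) auto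
      finally show ?thesis by simp
    qed
  qed
  ultimately show ?thesis using that K by blast
qed

text \<open>
  If \<open>a * x\<close> is small, then so are the cross terms in \<open>star y * y\<close> for
  \<open>y = x + t *\<^sub>R (star a * a)\<close>. Hence \<open>norm y\<close> exceeds 1 only by the small first order term
  \<open>t * R * \<delta>\<close> and a term of order \<open>t\<^sup>2\<close>, whereas \<open>Re (\<phi> y)\<close> is at least
  \<open>1 - \<epsilon> + t * Re (\<phi> (star a * a))\<close>. In applications \<open>t\<close> is chosen first, then \<open>\<epsilon>\<close> and \<open>\<delta>\<close>.
\<close>

lemma functional_le_of_small_product:
  fixes x :: "'a::cstar_algebra"
  assumes lin: "\<phi> \<in> dual_space" and contr: "\<And>a. cmod (\<phi> a) \<le> norm a"
    and x: "norm x \<le> 1" "1 - \<epsilon> \<le> Re (\<phi> x)" and t: "t > 0"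
    and a: "norm a \<le> R" "norm (a * x) \<le> \<delta>"
  shows "Re (\<phi> (star a * a)) \<le> R * \<delta> + t * R ^ 4 / 2 + \<epsilon> / t"
proof -
  have R: "R \<ge> 0" "\<delta> \<ge> 0" using a norm_ge_zero order_trans by blast+
  define c where "c = star a * a"
  have nc: "norm c \<le> R\<^sup>2" using a by (simp add: c_def cstar_identity power_mono)
  have sc: "star c = c" by (simp add: c_def star_mult star_star)
  have ncx: "norm (c * x) \<le> R * \<delta>"
  proof -
    have "norm (c * x) \<le> norm (star a) * norm (a * x)"
      unfolding c_def mult.assoc by (rule norm_mult_ineq)
    also have "\<dots> \<le> R * \<delta>" using a R by (intro mult_mono) auto
    finally show ?thesis .
  qed
  have nxc: "norm (star x * c) \<le> R * \<delta>"
    using ncx norm_star[of "c * x"] by (simp add: star_mult sc)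
  define y where "y = x + t *\<^sub>R c"
  have sy: "star y * y = (star x * x + t *\<^sub>R (star x * c)) + (t *\<^sub>R (c * x) + t\<^sup>2 *\<^sub>R (c * c))"
    by (simp add: y_def star_add star_scaleR sc distrib_left distrib_right power2_eq_square
        scaleR_add_right)
  have "(norm y)\<^sup>2 \<le> norm (star x * x) + norm (t *\<^sub>R (star x * c)) + (norm (t *\<^sub>R (c * x)) + norm (t\<^sup>2 *\<^sub>R (c * c)))"
    unfolding cstar_identity[symmetric, of y] sy
    using norm_triangle_ineq[of "star x * x + t *\<^sub>R (star x * c)" "t *\<^sub>R (c * x) + t\<^sup>2 *\<^sub>R (c * c)"]
      norm_triangle_ineq[of "star x * x" "t *\<^sub>R (star x * c)"]
      norm_triangle_ineq[of "t *\<^sub>R (c * x)" "t\<^sup>2 *\<^sub>R (c * c)"] by linarith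
  also have "\<dots> \<le> 1 + t * (R * \<delta>) + (t * (R * \<delta>) + t\<^sup>2 * (R\<^sup>2 * R\<^sup>2))"
  proof (intro add_mono)
    show "norm (star x * x) \<le> 1" using x by (simp add: cstar_identity power_le_one)
    show "norm (t *\<^sub>R (star x * c)) \<le> t * (R * \<delta>)" using nxc t by simp
    show "norm (t *\<^sub>R (c * x)) \<le> t * (R * \<delta>)" using ncx t by simp
    have "norm (c * c) \<le> R\<^sup>2 * R\<^sup>2"
      using norm_mult_ineq[of c c] mult_mono[OF nc nc] by simp
    then show "norm (t\<^sup>2 *\<^sub>R (c * c)) \<le> t\<^sup>2 * (R\<^sup>2 * R\<^sup>2)" by (simp add: mult_left_mono)
  qed
  also have "\<dots> \<le> (1 + t * (R * \<delta>) + t\<^sup>2 * R ^ 4 / 2)\<^sup>2"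
  proof -
    define u where "u = t * (R * \<delta>) + t\<^sup>2 * R ^ 4 / 2"
    have "1 + t * (R * \<delta>) + (t * (R * \<delta>) + t\<^sup>2 * (R\<^sup>2 * R\<^sup>2)) = 1 + 2 * u"
      by (simp add: u_def power_add[symmetric])
    also have "\<dots> \<le> (1 + u)\<^sup>2" by (simp add: power2_sum)
    finally show ?thesis by (simp add: u_def add.assoc)
  qed
  finally have "norm y \<le> 1 + t * (R * \<delta>) + t\<^sup>2 * R ^ 4 / 2"
    by (rule power2_le_imp_le) (use R t in simp)
  moreover have "Re (\<phi> y) \<le> norm y" using contr[of y] complex_Re_le_cmod[of "\<phi> y"] by linarith
  moreover have "Re (\<phi> y) = Re (\<phi> x) + t * Re (\<phi> c)"
    by (simp add: y_def dual_space_add[OF lin] dual_space_scaleR[OF lin])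
  ultimately have "t * Re (\<phi> c) \<le> t * (R * \<delta>) + t\<^sup>2 * R ^ 4 / 2 + \<epsilon>" using x by linarith
  also have "\<dots> = t * (R * \<delta> + t * R ^ 4 / 2 + \<epsilon> / t)"
    using t by (simp add: power2_eq_square field_simps)
  finally show ?thesis using t by (simp add: c_def)
qed

lemma state_almost_attains_norm:
  assumes \<phi>: "\<phi> \<in> state_space" and \<epsilon>: "\<epsilon> > 0"
  obtains x where "norm x \<le> 1" "1 - \<epsilon> < Re (\<phi> x)"
proof -
  have bl: "bounded_linear \<phi>" "onorm \<phi> = 1" using \<phi> by (auto simp: state_space_def dual_space_def)
  have "\<exists>x. max 0 (1 - \<epsilon>) * norm x < cmod (\<phi> x)"
  proof (rule ccontr)
    assume "\<nexists>x. max 0 (1 - \<epsilon>) * norm x < cmod (\<phi> x)"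
    then have "onorm \<phi> \<le> max 0 (1 - \<epsilon>)" by (intro onorm_bound) (auto simp: not_less)
    then show False using bl(2) \<epsilon> by simp
  qed
  then obtain x where x: "max 0 (1 - \<epsilon>) * norm x < cmod (\<phi> x)" by blast
  then have x0: "norm x > 0" using linear_0[OF bounded_linear.linear[OF bl(1)]] by auto
  define y where "y = scaleC (cnj (sgn (\<phi> x)) / of_real (norm x)) x"
  have "\<phi> y = of_real (cmod (\<phi> x) / norm x)"
    using cnj_sgn_mult[of "\<phi> x"] by (simp add: y_def dual_space_scaleC[OF state_space_dual[OF \<phi>]])
  moreover have "1 - \<epsilon> < cmod (\<phi> x) / norm x"
  proof -
    have "(1 - \<epsilon>) * norm x \<le> max 0 (1 - \<epsilon>) * norm x" by (intro mult_right_mono) auto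
    with x have "(1 - \<epsilon>) * norm x < cmod (\<phi> x)" by linarith
    then show ?thesis using x0 by (simp only: pos_less_divide_eq)
  qed
  ultimately have "1 - \<epsilon> < Re (\<phi> y)" by (simp only: Re_complex_of_real)
  moreover have "norm y \<le> 1" using x0 by (simp add: y_def norm_scaleC norm_divide norm_sgn)
  ultimately show ?thesis using that by blast
qed

text \<open>
  Each condition \<open>1 - \<epsilon> < Re (\<phi> x)\<close> is weak* open in \<open>\<phi>\<close>, so finitely many of them cover \<open>K\<close>.
\<close>

lemma compact_states_uniformly_attain:
  fixes K :: "('a::cstar_algebra \<Rightarrow> complex) set"
  assumes K: "K \<subseteq> state_space" "compact K" and \<epsilon>: "\<epsilon> > 0"
  obtains X where "finite X" "\<And>x. x \<in> X \<Longrightarrow> norm x \<le> 1" "\<And>\<phi>. \<phi> \<in> K \<Longrightarrow> \<exists>x\<in>X. 1 - \<epsilon> < Re (\<phi> x)"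
proof -
  define U where "U x = {\<phi>::'a \<Rightarrow> complex. 1 - \<epsilon> < Re (\<phi> x)}" for x
  have op: "open (U x)" for x
    unfolding U_def by (intro open_Collect_less continuous_intros continuous_on_product_coordinates)
  have "K \<subseteq> (\<Union>x\<in>cball 0 1. U x)"
  proof
    fix \<phi> assume "\<phi> \<in> K"
    then obtain x where "norm x \<le> 1" "1 - \<epsilon> < Re (\<phi> x)"
      using state_almost_attains_norm[of \<phi> \<epsilon>] K \<epsilon> by blast
    then show "\<phi> \<in> (\<Union>x\<in>cball 0 1. U x)" by (auto simp: U_def)
  qed
  then obtain X where X: "X \<subseteq> cball 0 1" "finite X" "K \<subseteq> (\<Union>x\<in>X. U x)"
    using compactE_image[OF K(2), of "cball 0 1" U] op by blast
  show ?thesis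
  proof (rule that[OF X(2)])
    show "norm x \<le> 1" if "x \<in> X" for x using X(1) that by auto
    show "\<exists>x\<in>X. 1 - \<epsilon> < Re (\<phi> x)" if "\<phi> \<in> K" for \<phi>
      using X(3) that by (auto simp: U_def)
  qed
qed

lemma su_seminorm_small_of_products:
  fixes K :: "('a::cstar_algebra \<Rightarrow> complex) set"
  assumes K: "K \<subseteq> state_space" "compact K" and e: "e > 0"
  obtains X \<delta> where "finite X" "\<delta> > 0"
    "\<forall>a. norm a \<le> R \<longrightarrow> (\<forall>x\<in>X. norm (a * x) < \<delta> \<and> norm (x * a) < \<delta>)
      \<longrightarrow> su_seminorm K a < e"
proof -
  \<comment> \<open>The three terms of the bound in \<open>functional_le_of_small_product\<close> become a quarter of \<open>h\<close> each;
    \<open>M\<close> is a positive bound for the norm even if \<open>R \<le> 0\<close>.\<close>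
  define M where "M = \<bar>R\<bar> + 1"
  define h where "h = (e / 2)\<^sup>2"
  define t where "t = h / (2 * M ^ 4)"
  define \<epsilon> where "\<epsilon> = t * h / 4"
  define \<delta> where "\<delta> = h / (4 * M)"
  have pos: "M > 0" "h > 0" "t > 0" "\<epsilon> > 0" "\<delta> > 0"
    using e by (simp_all add: M_def h_def t_def \<epsilon>_def \<delta>_def add_nonneg_pos)
  have sum: "M * \<delta> + t * M ^ 4 / 2 + \<epsilon> / t \<le> h"
    using pos by (simp add: \<delta>_def \<epsilon>_def t_def)
  obtain X where X: "finite X" "\<And>x. x \<in> X \<Longrightarrow> norm x \<le> 1" "\<And>\<phi>. \<phi> \<in> K \<Longrightarrow> \<exists>x\<in>X. 1 - \<epsilon> < Re (\<phi> x)"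
    using compact_states_uniformly_attain[OF K pos(4)] by blast
  \<comment> \<open>The adjoints are included because the term with \<open>a * star a\<close> needs \<open>star a * x\<close> to be small,
    which is the adjoint of \<open>star x * a\<close>.\<close>
  let ?X = "X \<union> star ` X"
  have "su_seminorm K a < e"
    if a: "norm a \<le> R" "\<And>x. x \<in> ?X \<Longrightarrow> norm (a * x) < \<delta> \<and> norm (x * a) < \<delta>" for a
  proof -
    have "su_seminorm K a \<le> e / 2"
    proof (rule su_seminorm_least)
      fix \<phi> assume \<phi>K: "\<phi> \<in> K"
      then have \<phi>: "\<phi> \<in> state_space" using K by blast
      obtain x where x: "x \<in> X" "1 - \<epsilon> < Re (\<phi> x)" using X(3)[OF \<phi>K] by blast
      have aM: "norm a \<le> M" using a(1) by (simp add: M_def)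
      have "norm (star a * x) = norm (star x * a)"
        using norm_star[of "star a * x"] by (simp add: star_mult star_star)
      then have small: "norm (a * x) \<le> \<delta>" "norm (star a * x) \<le> \<delta>"
        using a(2)[of x] a(2)[of "star x"] x(1) by (auto simp: less_imp_le)
      note bound = functional_le_of_small_product[OF state_space_dual[OF \<phi>] state_space_norm_le[OF \<phi>]
          X(2)[OF x(1)] less_imp_le[OF x(2)] pos(3)]
      have "Re (\<phi> (star a * a)) \<le> h" using bound[OF aM small(1)] sum by linarith
      then show "sqrt (Re (\<phi> (star a * a))) \<le> e / 2"
        unfolding h_def by (rule real_le_lsqrt[rotated]) (use e in simp)
      have "Re (\<phi> (a * star a)) \<le> h"
        using bound[of "star a" M \<delta>] aM small(2) sum by (simp add: star_star)
      then show "sqrt (Re (\<phi> (a * star a))) \<le> e / 2"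
        unfolding h_def by (rule real_le_lsqrt[rotated]) (use e in simp)
    qed (use e in simp)
    then show ?thesis using e by linarith
  qed
  then show ?thesis using that[of ?X \<delta>] X(1) pos(5) by blast
qed

text \<open>
  The hypothesis \<open>dom\<close> compares the two families near the origin of a ball only. It applies at every
  point \<open>z\<close> of \<open>B\<close>, because \<open>y - z\<close> stays in the ball of radius \<open>2 * R\<close> while \<open>y\<close> runs through \<open>B\<close>.
\<close>

lemma seminorm_topology_finer_on_bounded:
  fixes B :: "'a::real_normed_vector set"
  assumes B: "bounded B"
    and sub: "\<And>p x y. p \<in> Q \<Longrightarrow> p (x + y) \<le> p x + p y"
    and zero: "\<And>q. q \<in> P \<Longrightarrow> q 0 = 0"
    and dom: "\<And>p e R. p \<in> Q \<Longrightarrow> e > 0 \<Longrightarrow> \<exists>F \<delta>. finite F \<and> F \<subseteq> P \<and> \<delta> > 0 \<and>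
      (\<forall>a. norm a \<le> R \<longrightarrow> (\<forall>q\<in>F. q a < \<delta>) \<longrightarrow> p a < e)"
    and U: "openin (subtopology (seminorm_topology Q) B) U"
  shows "openin (subtopology (seminorm_topology P) B) U"
proof -
  let ?S = "insert UNIV {{y. p (y - x) < e} | p x e. p \<in> Q \<and> e > (0::real)}"
  let ?T = "subtopology (seminorm_topology P) B"
  obtain R where R: "\<And>x. x \<in> B \<Longrightarrow> norm x \<le> R" using B bounded_iff by blast
  have top: "topspace ?T = B" by simp
  have "continuous_map ?T (topology_generated_by ?S) (\<lambda>x. x)"
  proof (rule continuous_on_generated_topo)
    fix V assume "V \<in> ?S"
    then consider "V = UNIV" | p x e where "V = {y. p (y - x) < e}" "p \<in> Q" "e > 0" by blast
    then show "openin ?T ((\<lambda>x. x) -` V \<inter> topspace ?T)"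
    proof cases
      case 1 then show ?thesis using openin_topspace[of ?T] by (simp only: vimage_UNIV Int_UNIV_left)
    next
      case 2
      show ?thesis unfolding top
      proof (subst openin_subopen, safe)
        fix z assume z: "z \<in> B" "z \<in> V"
        then have e': "e - p (z - x) > 0" using 2 by simp
        obtain F \<delta> where F: "finite F" "F \<subseteq> P" "\<delta> > 0"
          "\<forall>a. norm a \<le> 2 * R \<longrightarrow> (\<forall>q\<in>F. q a < \<delta>) \<longrightarrow> p a < e - p (z - x)"
          using dom[OF 2(2) e', of "2 * R"] by (elim exE conjE)
        let ?W = "\<Inter>(insert UNIV ((\<lambda>q. {y. q (y - z) < \<delta>}) ` F))"
        have "openin (seminorm_topology P) ?W"
        proof (rule openin_Inter)
          fix W assume "W \<in> insert UNIV ((\<lambda>q. {y. q (y - z) < \<delta>}) ` F)"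
          then consider "W = UNIV" | q where "q \<in> F" "W = {y. q (y - z) < \<delta>}" by blast
          then show "openin (seminorm_topology P) W"
          proof cases
            case 1
            then show ?thesis using openin_topspace[of "seminorm_topology P"] by simp
          next
            case q: 2
            have "W \<in> insert UNIV {{y. p (y - x) < e} | p x e. p \<in> P \<and> e > (0::real)}"
              unfolding q(2) using q(1) F(2,3) by blast
            then show ?thesis
              unfolding seminorm_topology_def by (rule topology_generated_by_Basis)
          qed
        next
          show "finite (insert UNIV ((\<lambda>q. {y. q (y - z) < \<delta>}) ` F))" using F(1) by simp
        qed simp
        then have "openin ?T (?W \<inter> B)" by (rule openin_subtopology_Int)
        moreover have "z \<in> ?W \<inter> B"
        proof -
          have "q (z - z) < \<delta>" if "q \<in> F" for q using zero[of q] F(2,3) that by auto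
          then show ?thesis using z(1) by blast
        qed
        moreover have "?W \<inter> B \<subseteq> (\<lambda>x. x) -` V \<inter> B"
        proof
          fix y assume y: "y \<in> ?W \<inter> B"
          have "norm (y - z) \<le> 2 * R"
            using norm_triangle_ineq4[of y z] R[of y] R[of z] y z by simp
          moreover have "q (y - z) < \<delta>" if "q \<in> F" for q using y that by blast
          ultimately have "p (y - z) < e - p (z - x)" using F(4) by blast
          moreover have "p (y - x) \<le> p (y - z) + p (z - x)" using sub[OF 2(2), of "y - z" "z - x"] by simp
          ultimately show "y \<in> (\<lambda>x. x) -` V \<inter> B" using y 2 by simp
        qed
        ultimately show "\<exists>T. openin ?T T \<and> z \<in> T \<and> T \<subseteq> (\<lambda>x. x) -` V \<inter> B" by blast
      qed
    qed
  qed simp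
  then have cont: "continuous_map ?T (seminorm_topology Q) (\<lambda>x. x)"
    by (simp only: seminorm_topology_def)
  obtain V where V: "openin (seminorm_topology Q) V" "U = V \<inter> B"
    using U by (auto simp: openin_subtopology)
  have "openin ?T {x \<in> topspace ?T. x \<in> V}" by (rule openin_continuous_map_preimage[OF cont V(1)])
  moreover have "{x \<in> topspace ?T. x \<in> V} = U" using V by auto
  ultimately show ?thesis by simp
qed

theorem theorem3p20:
  fixes B :: "'a::cstar_algebra set"
  assumes "separable_space (euclidean :: 'a topology)"
    and "bounded B"
  shows "subtopology strict_topology B = subtopology su_topology B"
proof -
  let ?P = "range (\<lambda>b a::'a. norm (b * a)) \<union> range (\<lambda>b a. norm (a * b))"
  let ?Q = "{su_seminorm K | K::('a \<Rightarrow> complex) set. K \<subseteq> state_space \<and> compactin weak_star_topology K}"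
  have Psub: "p (x + y) \<le> p x + p y" if "p \<in> ?P" for p x y
    using that by (auto simp: distrib_left distrib_right norm_triangle_ineq)
  have Pzero: "p 0 = 0" if "p \<in> ?P" for p using that by auto
  have Qsub: "p (x + y) \<le> p x + p y" if "p \<in> ?Q" for p x y
    using that su_seminorm_triangle by blast
  have Qzero: "p 0 = 0" if "p \<in> ?Q" for p using that su_seminorm_zero by auto
  have strict_dom: "\<exists>F \<delta>. finite F \<and> F \<subseteq> ?P \<and> \<delta> > 0 \<and>
      (\<forall>a. norm a \<le> R \<longrightarrow> (\<forall>q\<in>F. q a < \<delta>) \<longrightarrow> p a < e)"
    if p: "p \<in> ?Q" and e: "e > 0" for p e R
  proof -
    obtain K where K: "p = su_seminorm K" "K \<subseteq> state_space" "compact K"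
      using p by (auto simp: compactin_weak_star_iff)
    obtain X \<delta> where X: "finite X" "\<delta> > 0" "\<forall>a. norm a \<le> R \<longrightarrow>
        (\<forall>x\<in>X. norm (a * x) < \<delta> \<and> norm (x * a) < \<delta>) \<longrightarrow> su_seminorm K a < e"
      by (rule su_seminorm_small_of_products[OF K(2,3) e, where R = R])
    let ?F = "(\<lambda>x a. norm (x * a)) ` X \<union> (\<lambda>x a. norm (a * x)) ` X"
    have "\<forall>a. norm a \<le> R \<longrightarrow> (\<forall>q\<in>?F. q a < \<delta>) \<longrightarrow> p a < e"
    proof (intro allI impI)
      fix a assume a: "norm a \<le> R" "\<forall>q\<in>?F. q a < \<delta>"
      have "norm (a * x) < \<delta> \<and> norm (x * a) < \<delta>" if "x \<in> X" for x
        using bspec[OF a(2), of "\<lambda>a. norm (a * x)"] bspec[OF a(2), of "\<lambda>a. norm (x * a)"] that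
        by blast
      then show "p a < e" using X(3) a(1) K(1) by blast
    qed
    moreover have "finite ?F" "?F \<subseteq> ?P" using X(1) by auto
    ultimately show ?thesis using X(2) by blast
  qed
  have right: "\<exists>K. K \<subseteq> state_space \<and> compactin weak_star_topology K \<and> (\<exists>\<delta>>0. \<forall>a. norm a \<le> R \<longrightarrow>
      su_seminorm K a < \<delta> \<longrightarrow> norm (a * b) < e)"
    if e: "e > 0" for b :: 'a and e R :: real
  proof -
    define \<epsilon> where "\<epsilon> = e\<^sup>2 / (R\<^sup>2 + 1)"
    have R1: "R\<^sup>2 + 1 > 0" by (simp add: add_nonneg_pos)
    have \<epsilon>: "\<epsilon> > 0" using e R1 by (simp add: \<epsilon>_def)
    obtain K where K: "K \<subseteq> state_space" "compactin weak_star_topology K"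
      "\<And>a. (norm (a * b))\<^sup>2 \<le> max ((norm b)\<^sup>2 * (su_seminorm K a)\<^sup>2) ((norm a)\<^sup>2 * \<epsilon>)"
      using norm_mult_right_le_su_seminorm[OF \<epsilon>] by blast
    define \<delta> where "\<delta> = e / (norm b + 1)"
    have b1: "norm b + 1 > 0" by (simp add: add_nonneg_pos)
    have \<delta>: "\<delta> > 0" using e b1 by (simp add: \<delta>_def)
    have "norm (a * b) < e" if a: "norm a \<le> R" "su_seminorm K a < \<delta>" for a
    proof -
      have "norm b * su_seminorm K a \<le> norm b * \<delta>" using a(2) by (intro mult_left_mono) auto
      also have "\<dots> < (norm b + 1) * \<delta>" using \<delta> by (simp add: algebra_simps)
      also have "\<dots> = e" using b1 by (simp add: \<delta>_def)
      finally have "(norm b * su_seminorm K a)\<^sup>2 < e\<^sup>2"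
        using su_seminorm_nonneg[OF K(1)] by (intro power_strict_mono) auto
      moreover have "(norm a)\<^sup>2 * \<epsilon> < e\<^sup>2"
      proof -
        have "(norm a)\<^sup>2 * \<epsilon> \<le> R\<^sup>2 * \<epsilon>" using a(1) \<epsilon> by (intro mult_right_mono power_mono) auto
        also have "\<dots> < (R\<^sup>2 + 1) * \<epsilon>" using \<epsilon> by (simp add: algebra_simps)
        also have "\<dots> = e\<^sup>2" using R1 by (simp add: \<epsilon>_def)
        finally show ?thesis .
      qed
      ultimately have "(norm (a * b))\<^sup>2 < e\<^sup>2" using K(3)[of a] by (simp add: power_mult_distrib)
      then show ?thesis by (rule power2_less_imp_less) (use e in simp)
    qed
    then show ?thesis using K \<delta> by blast
  qed
  have su_dom: "\<exists>F \<delta>. finite F \<and> F \<subseteq> ?Q \<and> \<delta> > 0 \<and>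
      (\<forall>a. norm a \<le> R \<longrightarrow> (\<forall>q\<in>F. q a < \<delta>) \<longrightarrow> p a < e)"
    if p: "p \<in> ?P" and e: "e > 0" for p e R
  proof -
    have "\<exists>K. K \<subseteq> state_space \<and> compactin weak_star_topology K \<and> (\<exists>\<delta>>0. \<forall>a. norm a \<le> R \<longrightarrow>
      su_seminorm K a < \<delta> \<longrightarrow> p a < e)"
      using p
    proof
      assume "p \<in> range (\<lambda>b a. norm (a * b))"
      then show ?thesis using right[OF e] by auto
    next
      assume "p \<in> range (\<lambda>b a. norm (b * a))"
      then obtain b where b: "p = (\<lambda>a. norm (b * a))" by blast
      obtain K \<delta> where K: "K \<subseteq> state_space" "compactin weak_star_topology K" "\<delta> > 0"
        "\<And>a. norm a \<le> R \<Longrightarrow> su_seminorm K a < \<delta> \<Longrightarrow> norm (a * star b) < e"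
        using right[OF e, of R "star b"] by blast
      have "p a < e" if "norm a \<le> R" "su_seminorm K a < \<delta>" for a
        using K(4)[of "star a"] that norm_star[of "b * a"] by (simp add: b su_seminorm_star star_mult)
      then show ?thesis using K by blast
    qed
    then obtain K \<delta> where K: "K \<subseteq> state_space" "compactin weak_star_topology K" "\<delta> > 0"
        "\<And>a. norm a \<le> R \<Longrightarrow> su_seminorm K a < \<delta> \<Longrightarrow> p a < e" by blast
    then show ?thesis by (intro exI[of _ "{su_seminorm K}"] exI[of _ \<delta>]) auto
  qed
  have "openin (subtopology (seminorm_topology ?Q) B) U"
    if "openin (subtopology (seminorm_topology ?P) B) U" for U
  proof (rule seminorm_topology_finer_on_bounded[where Q = ?P and P = ?Q, OF assms(2) _ _ _ that])
    show "p (x + y) \<le> p x + p y" if "p \<in> ?P" for p x y using that by (rule Psub)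
    show "q 0 = 0" if "q \<in> ?Q" for q using that by (rule Qzero)
  qed (rule su_dom)
  moreover have "openin (subtopology (seminorm_topology ?P) B) U"
    if "openin (subtopology (seminorm_topology ?Q) B) U" for U
  proof (rule seminorm_topology_finer_on_bounded[where Q = ?Q and P = ?P, OF assms(2) _ _ _ that])
    show "p (x + y) \<le> p x + p y" if "p \<in> ?Q" for p x y using that by (rule Qsub)
    show "q 0 = 0" if "q \<in> ?P" for q using that by (rule Pzero)
  qed (rule strict_dom)
  ultimately show ?thesis
    unfolding topology_eq strict_topology_def su_topology_def by blast
qed

end
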